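(* Let $K_M$ be the class of all space-group pairs $(X,G)$ in which $X$ is a nonempty open subset of a locally convex metrizable topological vector space, and $G\subseteq H(X)$ is a group containing all locally bi-uniformly continuous homeomorphisms of $X$. Then $K_M$ is faithful.
   Context: Vector spaces are real. For a topological space $X$, $H(X)$ is the group of all auto-homeomorphisms of $X$. A space-group pair is a pair $(X,G)$ where $X$ is a topological space and $G$ is a subgroup of $H(X)$. A class $K$ of space-group pairs is faithful if for every $(X,G),(Y,H)\in K$ and every group isomorphism $\varphi:G\to H$ there is a homeomorphism $\tau$ from $X$ onto $Y$ such that $\varphi(g)=\tau\circ g\circ\tau^{-1}$ for every $g\in G$. Uniform continuity is with respect to the uniformity of the topological group $(E,+)$, where $E$ is the ambient topological vector space (equivalently, the uniformity of any $+$-invariant metric inducing the topology of $E$). A homeomorphism $h\in H(X)$ is locally bi-uniformly continuous if every $x\in X$ has an open neighborhood $U$ such that $h\restriction U$ and its inverse $h^{-1}\restriction h(U)$ are uniformly continuous. *)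

theory Defs
  imports "HOL-Analysis.Analysis" "HOL-Algebra.Bij"
begin

text \<open>
  The superclass \<^class>\<open>uniform_topological_group_add\<close> adds no freedom beyond the topology:
  by \<open>uniformity_eq\<close> the uniformity is that of the topological group \<open>(E,+)\<close>, so the
  library's \<^const>\<open>uniformly_continuous_on\<close> is uniform continuity in the sense of this group.
\<close>

class topological_real_vector = real_vector + uniform_topological_group_add +
  assumes tendsto_scaleR_Pair:
    "LIM p (nhds c \<times>\<^sub>F nhds x). fst p *\<^sub>R snd p :> nhds (c *\<^sub>R x)"

definition locally_convex_space :: "'a::topological_real_vector itself \<Rightarrow> bool" where
  "locally_convex_space _ \<longleftrightarrow>
    (\<forall>U. open U \<and> (0 :: 'a) \<in> U \<longrightarrow> (\<exists>V. open V \<and> convex V \<and> 0 \<in> V \<and> V \<subseteq> U))"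

lemma uniformity_eq:
  "uniformity = filtercomap (\<lambda>(x, y). y - x) (nhds (0 :: 'a :: uniform_topological_group_add))"
  by (rule cauchy_seq_finset_iff_vanishing)

text \<open>
  Elements of \<open>H(X)\<close> are represented by functions that are \<^term>\<open>undefined\<close> outside the
  space (as in \<^const>\<open>Bij\<close>), so that equality of functions is equality of maps on \<open>X\<close>;
  the group operation is composition.
\<close>

definition homeo_group :: "'a topology \<Rightarrow> ('a \<Rightarrow> 'a) monoid" where
  "homeo_group X =
    BijGroup (topspace X) \<lparr>carrier := {h \<in> Bij (topspace X). homeomorphic_map X X h}\<rparr>"

definition space_group_pair :: "'a topology \<Rightarrow> ('a \<Rightarrow> 'a) set \<Rightarrow> bool" where
  "space_group_pair X G \<longleftrightarrow> subgroup G (homeo_group X)"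

lemma group_homeo_group: "group (homeo_group X)"
proof -
  have "subgroup {h \<in> Bij (topspace X). homeomorphic_map X X h} (BijGroup (topspace X))"
  proof (rule group.subgroupI[OF group_BijGroup])
    show "{h \<in> Bij (topspace X). homeomorphic_map X X h} \<subseteq> carrier (BijGroup (topspace X))"
      by (auto simp: BijGroup_def)
    have "homeomorphic_map X X (\<lambda>x\<in>topspace X. x)"
    proof (rule homeomorphic_map_eq)
      show "homeomorphic_map X X id"
        unfolding homeomorphic_map_id ..
    qed (simp only: restrict_apply' id_apply)
    then show "{h \<in> Bij (topspace X). homeomorphic_map X X h} \<noteq> {}"
      using id_Bij by blast
  next
    fix h assume h: "h \<in> {h \<in> Bij (topspace X). homeomorphic_map X X h}"
    then obtain k where k: "homeomorphic_maps X X h k"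
      unfolding homeomorphic_map_maps by blast
    have "inv_into (topspace X) h y = k y" if "y \<in> topspace X" for y
    proof (rule inv_into_f_eq)
      show "inj_on h (topspace X)"
        using h by (simp add: Bij_def bij_betw_def)
      show "k y \<in> topspace X" "h (k y) = y"
        using k that by (simp_all add: homeomorphic_maps_def continuous_map_def Pi_iff)
    qed
    then have "homeomorphic_map X X (\<lambda>x\<in>topspace X. inv_into (topspace X) h x)"
      using k unfolding homeomorphic_maps_map
      by (metis (no_types, lifting) homeomorphic_map_eq restrict_apply')
    then show "inv\<^bsub>BijGroup (topspace X)\<^esub> h \<in> {h \<in> Bij (topspace X). homeomorphic_map X X h}"
      using h by (simp add: inv_BijGroup restrict_inv_into_Bij)
  next
    fix g h assume gh: "g \<in> {h \<in> Bij (topspace X). homeomorphic_map X X h}"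
      "h \<in> {h \<in> Bij (topspace X). homeomorphic_map X X h}"
    have "homeomorphic_map X X (compose (topspace X) g h)"
    proof (rule homeomorphic_map_eq)
      show "homeomorphic_map X X (g \<circ> h)"
        using gh by (blast intro: homeomorphic_map_compose)
    qed (simp only: compose_eq o_apply)
    then show "g \<otimes>\<^bsub>BijGroup (topspace X)\<^esub> h \<in> {h \<in> Bij (topspace X). homeomorphic_map X X h}"
      using gh by (simp add: BijGroup_def compose_Bij)
  qed
  then show ?thesis
    unfolding homeo_group_def by (rule subgroup.subgroup_is_group[OF _ group_BijGroup])
qed

text \<open>
  A class of space-group pairs may contain spaces over different types, so it is given by a
  type-polymorphic set \<open>K\<close>, and faithfulness of the class is \<open>faithful K K\<close> with the two
  occurrences of \<open>K\<close> at independent types.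
\<close>

definition faithful ::
  "('a topology \<times> ('a \<Rightarrow> 'a) set) set \<Rightarrow> ('b topology \<times> ('b \<Rightarrow> 'b) set) set \<Rightarrow> bool" where
  "faithful K L \<longleftrightarrow>
    (\<forall>(X, G) \<in> K. \<forall>(Y, H) \<in> L.
      \<forall>\<phi> \<in> iso (homeo_group X \<lparr>carrier := G\<rparr>) (homeo_group Y \<lparr>carrier := H\<rparr>).
        \<exists>\<tau>. homeomorphic_map X Y \<tau> \<and>
          (\<forall>g\<in>G. \<forall>y\<in>topspace Y. \<phi> g y = \<tau> (g (inv_into (topspace X) \<tau> y))))"

definition locally_bi_uniformly_continuous ::
  "'a::uniform_space set \<Rightarrow> ('a \<Rightarrow> 'a) \<Rightarrow> bool" where
  "locally_bi_uniformly_continuous X h \<longleftrightarrow>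
    (\<forall>x\<in>X. \<exists>U. openin (top_of_set X) U \<and> x \<in> U \<and>
      uniformly_continuous_on U h \<and> uniformly_continuous_on (h ` U) (inv_into X h))"

definition K_M :: "('a::topological_real_vector topology \<times> ('a \<Rightarrow> 'a) set) set" where
  "K_M = {(top_of_set X, G) | X G.
    locally_convex_space TYPE('a) \<and> metrizable_space (euclidean :: 'a topology) \<and>
    open X \<and> X \<noteq> {} \<and> space_group_pair (top_of_set X) G \<and>
    {h \<in> carrier (homeo_group (top_of_set X)). locally_bi_uniformly_continuous X h} \<subseteq> G}"

end

theory Submission
  imports Defs
begin

text \<open>
  Rubin's algebraic disjointness recovers, from the group structure alone, the relation
  \<open>supp f \<subseteq> closure (supp f')\<close>. Hence any property of sequences of supports phrased through
  this relation and conjugation is preserved by group isomorphisms. The property \<open>point_seq\<close>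
  characterizes the decreasing sequences \<open>f\<close> whose supports form a neighbourhood base of a point.
  Its main conditions are that small elements supported in a neighbourhood can squeeze some support
  into any prescribed small open set, and that no group element can fix part of every support while
  expelling the rest. A sequence without limit point violates them: after squeezing it into a tiny
  set with closure in the space, one picks points in its members on distinct parallel lines; these
  points have a locally finite family of tubes along the lines, each missing all other points, and a
  locally uniform shear pushes every second point far away while fixing the others. No local
  compactness is needed.
\<close>

section \<open>Algebraic disjointness\<close>

text \<open>Only locally bi-uniformly continuous homeomorphisms are guaranteed to lie in the group,
  so every map that is constructed has to come with a modulus of continuity. Tent functions of
  Minkowski gauges provide one. The shear that breaks up a vanishing sequence uses infinitely many
  tents over thinner and thinner tubes, and these need not share a modulus; near each point,
  however, all but finitely many of them vanish. This is where locality in the definition enters.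
  The group sees supports only up to closure, so points are recovered from the regular open sets
  \<open>interior (closure (supp f))\<close>. Sequences suffice because metrizability gives a
  countable base at each point. In the zero space there are no small supports at all; its group is
  trivial and the case is settled directly.\<close>

context group
begin

definition commutator :: "'a \<Rightarrow> 'a \<Rightarrow> 'a" where
  "commutator f h = f \<otimes> h \<otimes> inv f \<otimes> inv h"

text \<open>When \<open>f\<close> and \<open>g\<close> have disjoint supports, \<open>f1\<close> and
  \<open>f2\<close> can be found inside the support of \<open>f\<close>. One commutator is not
  enough: \<open>commutator f2 h\<close> spreads onto the image under \<open>h\<close> of the
  support of \<open>f2\<close>, where \<open>g\<close> may act. Bracketing with \<open>f1\<close>
  removes that part.\<close>

definition alg_disjoint :: "'a \<Rightarrow> 'a \<Rightarrow> bool" where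
  "alg_disjoint f g \<longleftrightarrow> (\<forall>h\<in>carrier G. f \<otimes> h \<noteq> h \<otimes> f \<longrightarrow>
    (\<exists>f1\<in>carrier G. \<exists>f2\<in>carrier G. f1 \<otimes> g = g \<otimes> f1 \<and> f2 \<otimes> g = g \<otimes> f2 \<and>
      commutator f1 (commutator f2 h) \<noteq> \<one> \<and>
      commutator f1 (commutator f2 h) \<otimes> g = g \<otimes> commutator f1 (commutator f2 h)))"

text \<open>Algebraic disjointness of \<open>f'\<close> and \<open>g\<close> controls only the
  support of the twelfth power of \<open>g\<close>, so commutation is tested on that power.\<close>

definition below :: "'a \<Rightarrow> 'a \<Rightarrow> bool" where
  "below f f' \<longleftrightarrow> (\<forall>g\<in>carrier G. alg_disjoint f' g \<longrightarrow> f \<otimes> g [^] (12::nat) = g [^] (12::nat) \<otimes> f)"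

text \<open>Disjointness of supports is expressed through \<open>below\<close>, because
  \<open>alg_disjoint\<close> is only sandwiched between disjointness from the support of
  \<open>g\<close> and the weaker disjointness from that of \<open>g [^] 12\<close>.\<close>

definition separated :: "'a \<Rightarrow> 'a \<Rightarrow> bool" where
  "separated f f' \<longleftrightarrow> (\<forall>w\<in>carrier G. below w f \<and> below w f' \<longrightarrow> w = \<one>)"

definition conj_by :: "'a \<Rightarrow> 'a \<Rightarrow> 'a" where
  "conj_by g f = g \<otimes> f \<otimes> inv g"

text \<open>For a sequence converging to \<open>x\<close>, the last clause is the alternative
  \<open>g x \<noteq> x\<close> or \<open>g x = x\<close>, and the third is local transitivity at
  \<open>x\<close>. Conversely, the second clause keeps the supports from closing down on a set with
  interior, the third squeezes the sequence into small open sets, and the last makes an element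
  whose images meet the supports at all stages return them into every earlier closure.\<close>

definition point_seq :: "(nat \<Rightarrow> 'a) \<Rightarrow> bool" where
  "point_seq f \<longleftrightarrow> (\<forall>k. f k \<in> carrier G \<and> f k \<noteq> \<one> \<and> below (f (Suc k)) (f k)) \<and>
    (\<forall>w\<in>carrier G. (\<forall>k. below w (f k)) \<longrightarrow> w = \<one>) \<and>
    (\<forall>k. \<exists>j. \<forall>w\<in>carrier G. w \<noteq> \<one> \<longrightarrow> below w (f j) \<longrightarrow>
      (\<exists>g\<in>carrier G. below g (f k) \<and> (\<exists>m. below (conj_by g (f m)) w))) \<and>
    (\<forall>g\<in>carrier G. (\<exists>k. separated (conj_by g (f k)) (f k)) \<or>
      (\<forall>k. \<exists>j. below (conj_by g (f j)) (f k)))"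

lemma commutator_closed [simp]:
  "f \<in> carrier G \<Longrightarrow> h \<in> carrier G \<Longrightarrow> commutator f h \<in> carrier G"
  by (simp add: commutator_def)

lemma conj_by_closed [simp]: "g \<in> carrier G \<Longrightarrow> f \<in> carrier G \<Longrightarrow> conj_by g f \<in> carrier G"
  by (simp add: conj_by_def)

end

section \<open>Transport of the group-theoretic relations along an isomorphism\<close>

locale group_iso = G: group G + H: group H for G (structure) and H (structure) +
  fixes \<phi>
  assumes phi: "\<phi> \<in> iso G H"
begin

lemma phi_hom: "group_hom G H \<phi>"
  using phi by unfold_locales (auto simp: iso_def)

lemma phi_closed [simp]: "g \<in> carrier G \<Longrightarrow> \<phi> g \<in> carrier H"
  using phi_hom by (rule group_hom.hom_closed)

lemma phi_mult: "f \<in> carrier G \<Longrightarrow> g \<in> carrier G \<Longrightarrow> \<phi> (f \<otimes> g) = \<phi> f \<otimes>\<^bsub>H\<^esub> \<phi> g"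
  using phi_hom by (rule group_hom.hom_mult)

lemma phi_inv: "g \<in> carrier G \<Longrightarrow> \<phi> (inv g) = inv\<^bsub>H\<^esub> \<phi> g"
  using phi_hom by (rule group_hom.hom_inv)

lemma phi_pow: "g \<in> carrier G \<Longrightarrow> \<phi> (g [^] (n::nat)) = \<phi> g [^]\<^bsub>H\<^esub> n"
  by (rule hom_nat_pow[OF _ _ G.group_axioms H.group_axioms]) (use phi in \<open>auto simp: iso_def\<close>)

lemma phi_inj: "f \<in> carrier G \<Longrightarrow> g \<in> carrier G \<Longrightarrow> \<phi> f = \<phi> g \<longleftrightarrow> f = g"
  using phi by (auto simp: iso_def bij_betw_def inj_on_def)

lemma phi_one: "\<phi> \<one> = \<one>\<^bsub>H\<^esub>"
  using phi_hom by (rule group_hom.hom_one)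

lemma phi_eq_one: "f \<in> carrier G \<Longrightarrow> \<phi> f = \<one>\<^bsub>H\<^esub> \<longleftrightarrow> f = \<one>"
  using phi_inj[of f \<one>] by (simp add: phi_one)

lemma phi_surj: "carrier H = \<phi> ` carrier G"
  using phi by (auto simp: iso_def bij_betw_def)

text \<open>Together with \<open>bex_H\<close> this pulls quantifiers over the target group back to
  the source, so that invariance of each relation follows by rewriting with the homomorphism laws
  from right to left.\<close>

lemma ball_H: "(\<forall>h\<in>carrier H. P h) \<longleftrightarrow> (\<forall>g\<in>carrier G. P (\<phi> g))"
  by (simp add: phi_surj)

lemma bex_H: "(\<exists>h\<in>carrier H. P h) \<longleftrightarrow> (\<exists>g\<in>carrier G. P (\<phi> g))"
  by (simp add: phi_surj)

lemma phi_commutator: "f \<in> carrier G \<Longrightarrow> h \<in> carrier G \<Longrightarrow>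
    \<phi> (G.commutator f h) = H.commutator (\<phi> f) (\<phi> h)"
  by (simp add: G.commutator_def H.commutator_def phi_mult phi_inv)

lemma phi_conj_by: "f \<in> carrier G \<Longrightarrow> g \<in> carrier G \<Longrightarrow>
    \<phi> (G.conj_by g f) = H.conj_by (\<phi> g) (\<phi> f)"
  by (simp add: G.conj_by_def H.conj_by_def phi_mult phi_inv)

lemma alg_disjoint_iso:
  assumes "f \<in> carrier G" "g \<in> carrier G"
  shows "H.alg_disjoint (\<phi> f) (\<phi> g) \<longleftrightarrow> G.alg_disjoint f g"
  unfolding G.alg_disjoint_def H.alg_disjoint_def ball_H bex_H
  using assms by (simp add: phi_inj phi_eq_one
      flip: phi_commutator phi_mult cong: conj_cong ball_cong bex_cong)

lemma below_iso:
  assumes "f \<in> carrier G" "g \<in> carrier G"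
  shows "H.below (\<phi> f) (\<phi> g) \<longleftrightarrow> G.below f g"
  unfolding G.below_def H.below_def ball_H
  using assms by (simp add: phi_inj alg_disjoint_iso flip: phi_pow phi_mult)

lemma separated_iso:
  assumes "f \<in> carrier G" "g \<in> carrier G"
  shows "H.separated (\<phi> f) (\<phi> g) \<longleftrightarrow> G.separated f g"
  unfolding G.separated_def H.separated_def ball_H
  using assms by (simp add: below_iso phi_eq_one)

lemma point_seq_iso:
  assumes f: "\<And>k. f k \<in> carrier G"
  shows "H.point_seq (\<lambda>k. \<phi> (f k)) \<longleftrightarrow> G.point_seq f"
  unfolding G.point_seq_def H.point_seq_def ball_H bex_H
  using f by (simp add: below_iso separated_iso phi_eq_one flip: phi_conj_by cong: bex_cong)

end

section \<open>Groups acting with small supports\<close>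

text \<open>Separation is required of a set and not of the type: for the spaces in question it comes
  from metrizability, a hypothesis of the theorem, not from a type class.\<close>

definition hausdorff_on :: "'a::topological_space set \<Rightarrow> bool" where
  "hausdorff_on X \<longleftrightarrow> (\<forall>x\<in>X. \<forall>y\<in>X. x \<noteq> y \<longrightarrow>
    (\<exists>U V. open U \<and> open V \<and> x \<in> U \<and> y \<in> V \<and> U \<inter> V = {}))"

text \<open>Group elements are functions on the whole type, but only their values on
  \<open>X\<close> count; \<open>act_mult\<close>, \<open>act_one\<close> and \<open>act_eqI\<close>
  say so. The twelfth power in \<open>small_support\<close> matches \<open>below\<close>, which
  tests with twelfth powers.\<close>

locale small_supports = group G for G :: "('a::topological_space \<Rightarrow> 'a) monoid" (structure) +
  fixes X :: "'a set"
  assumes open_X: "open X"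
    and hausdorff_X: "hausdorff_on X"
    and act_closed [simp]: "\<And>g x. g \<in> carrier G \<Longrightarrow> x \<in> X \<Longrightarrow> g x \<in> X"
    and act_mult [simp]: "\<And>g h x. g \<in> carrier G \<Longrightarrow> h \<in> carrier G \<Longrightarrow> x \<in> X \<Longrightarrow> (g \<otimes> h) x = g (h x)"
    and act_one [simp]: "\<And>x. x \<in> X \<Longrightarrow> \<one> x = x"
    and act_eqI: "\<And>g h. g \<in> carrier G \<Longrightarrow> h \<in> carrier G \<Longrightarrow> (\<And>x. x \<in> X \<Longrightarrow> g x = h x) \<Longrightarrow> g = h"
    and act_cont: "\<And>g. g \<in> carrier G \<Longrightarrow> continuous_on X g"
    and small_support: "\<And>U. open U \<Longrightarrow> U \<noteq> {} \<Longrightarrow> U \<subseteq> X \<Longrightarrow>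
      \<exists>g\<in>carrier G. {x\<in>X. g x \<noteq> x} \<subseteq> U \<and> g [^] (12::nat) \<noteq> \<one>"
begin

definition supp :: "('a \<Rightarrow> 'a) \<Rightarrow> 'a set" where
  "supp g = {x\<in>X. g x \<noteq> x}"

lemma supp_subset: "supp g \<subseteq> X"
  by (auto simp: supp_def)

lemma not_supp: "x \<in> X \<Longrightarrow> x \<notin> supp g \<Longrightarrow> g x = x"
  by (simp add: supp_def)

lemma inv_act [simp]: "g \<in> carrier G \<Longrightarrow> x \<in> X \<Longrightarrow> (inv g) (g x) = x"
  by (metis act_mult act_one inv_closed l_inv)

lemma act_inv [simp]: "g \<in> carrier G \<Longrightarrow> x \<in> X \<Longrightarrow> g ((inv g) x) = x"
  by (metis act_mult act_one inv_closed r_inv)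

lemma act_inj: "g \<in> carrier G \<Longrightarrow> x \<in> X \<Longrightarrow> y \<in> X \<Longrightarrow> g x = g y \<longleftrightarrow> x = y"
  by (metis inv_act)

lemma act_image: "g \<in> carrier G \<Longrightarrow> A \<subseteq> X \<Longrightarrow> g ` A = {x\<in>X. (inv g) x \<in> A}"
  by (force simp: image_iff)

lemma open_vimage_act:
  assumes "g \<in> carrier G" "open U"
  shows "open {x\<in>X. g x \<in> U}"
  using continuous_open_preimage[OF act_cont open_X] assms by (simp add: vimage_def Int_def)

lemma open_image_act:
  assumes "g \<in> carrier G" "open U" "U \<subseteq> X"
  shows "open (g ` U)"
  using assms open_vimage_act[of "inv g" U] by (simp add: act_image)

lemma moved_nbhd:
  assumes g: "g \<in> carrier G" and x: "x \<in> X" "g x \<noteq> x" and O: "open O'" "x \<in> O'"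
  obtains U where "open U" "x \<in> U" "U \<subseteq> O'" "U \<subseteq> X" "\<And>y. y \<in> U \<Longrightarrow> g y \<notin> U"
proof -
  obtain A B where AB: "open A" "open B" "x \<in> A" "g x \<in> B" "A \<inter> B = {}"
    using hausdorff_X x g unfolding hausdorff_on_def by (metis act_closed)
  let ?U = "O' \<inter> A \<inter> {y\<in>X. g y \<in> B}"
  have "open ?U"
    using open_vimage_act[OF g] AB O by (intro open_Int) auto
  then show thesis
    by (rule that) (use AB O x in auto)
qed

lemma supp_open:
  assumes "g \<in> carrier G"
  shows "open (supp g)"
proof (subst open_subopen, intro ballI)
  fix x assume "x \<in> supp g"
  then have "x \<in> X" "g x \<noteq> x"
    by (auto simp: supp_def)
  then obtain U where "open U" "x \<in> U" "U \<subseteq> X" "\<And>y. y \<in> U \<Longrightarrow> g y \<notin> U"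
    using moved_nbhd[OF assms _ _ open_UNIV] by (metis UNIV_I)
  then show "\<exists>T. open T \<and> x \<in> T \<and> T \<subseteq> supp g"
    by (force simp: supp_def)
qed

lemma supp_empty_iff: "g \<in> carrier G \<Longrightarrow> supp g = {} \<longleftrightarrow> g = \<one>"
  using act_eqI[of g \<one>] by (auto simp: supp_def)

lemma supp_inv [simp]: "g \<in> carrier G \<Longrightarrow> supp (inv g) = supp g"
  unfolding supp_def by (metis act_inv inv_act)

lemma supp_mult: "f \<in> carrier G \<Longrightarrow> g \<in> carrier G \<Longrightarrow> supp (f \<otimes> g) \<subseteq> supp f \<union> supp g"
  unfolding supp_def by auto

lemma supp_conj:
  assumes "f \<in> carrier G" "g \<in> carrier G"
  shows "supp (g \<otimes> f \<otimes> inv g) = g ` supp f"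
  unfolding act_image[OF assms(2) supp_subset] using assms
  by (auto simp: supp_def) (metis act_closed inv_act inv_closed)

lemma supp_act_closed: "g \<in> carrier G \<Longrightarrow> x \<in> supp g \<Longrightarrow> g x \<in> supp g"
  by (auto simp: supp_def act_inj)

lemma commute_if_disjoint:
  assumes "f \<in> carrier G" "g \<in> carrier G" "supp f \<inter> supp g = {}"
  shows "f \<otimes> g = g \<otimes> f"
proof (rule act_eqI)
  fix x assume "x \<in> X"
  then show "(f \<otimes> g) x = (g \<otimes> f) x"
    using assms supp_act_closed[of f x] supp_act_closed[of g x] not_supp[of x f] not_supp[of x g]
      not_supp[of "f x" g] not_supp[of "g x" f]
    by (simp add: disjoint_iff) metis
qed (use assms in auto)

lemma supp_commute:
  assumes "f \<in> carrier G" "g \<in> carrier G" "f \<otimes> g = g \<otimes> f" "x \<in> supp f"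
  shows "g x \<in> supp f"
proof -
  have "f (g x) = g (f x)" "x \<in> X" "f x \<noteq> x"
    using assms by (auto simp: supp_def simp flip: act_mult)
  then show ?thesis
    using assms by (simp add: supp_def act_inj)
qed

lemma nontrivial_in:
  assumes "open U" "U \<noteq> {}" "U \<subseteq> X"
  obtains g x where "g \<in> carrier G" "supp g \<subseteq> U" "x \<in> supp g" "x \<in> U" "x \<in> X" "g x \<noteq> x" "g \<noteq> \<one>"
proof -
  obtain g where g: "g \<in> carrier G" "supp g \<subseteq> U" "g [^] (12::nat) \<noteq> \<one>"
    using small_support[OF assms] by (auto simp: supp_def)
  then have "g \<noteq> \<one>"
    by auto
  then obtain x where "x \<in> supp g"
    using g supp_empty_iff by blast
  then show thesis
    using that[of g x] g \<open>g \<noteq> \<one>\<close> by (auto simp: supp_def)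
qed

text \<open>All takes place in an open \<open>U\<close> inside \<open>supp f\<close> that
  \<open>h\<close> moves off itself: \<open>f2\<close> lives on \<open>U\<close>, and
  \<open>f1\<close> on a smaller \<open>V\<close> that \<open>f2\<close> moves off itself. The
  double commutator is then \<open>f1\<close> times an element living on the image of
  \<open>V\<close> under \<open>f2\<close>, hence nontrivial, and it is supported in
  \<open>U\<close>, away from \<open>g\<close>.\<close>

lemma alg_disjoint_if_disjoint:
  assumes f: "f \<in> carrier G" and g: "g \<in> carrier G" and disj: "supp f \<inter> supp g = {}"
  shows "alg_disjoint f g"
  unfolding alg_disjoint_def
proof (intro ballI impI)
  fix h assume h: "h \<in> carrier G" and "f \<otimes> h \<noteq> h \<otimes> f"
  then obtain x where x: "x \<in> supp f" "x \<in> supp h"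
    using commute_if_disjoint f by blast
  then obtain U where U: "open U" "x \<in> U" "U \<subseteq> supp f" "U \<subseteq> X" "\<And>y. y \<in> U \<Longrightarrow> h y \<notin> U"
    using moved_nbhd[OF h, of x "supp f"] supp_open[OF f] by (auto simp: supp_def)
  obtain f2 x2 where f2: "f2 \<in> carrier G" "supp f2 \<subseteq> U" "x2 \<in> supp f2" "x2 \<in> U" "x2 \<in> X" "f2 x2 \<noteq> x2" "f2 \<noteq> \<one>"
    by (rule nontrivial_in[OF U(1) _ U(4)]) (use U(2) in blast)+
  obtain V where V: "open V" "x2 \<in> V" "V \<subseteq> U" "V \<subseteq> X" "\<And>y. y \<in> V \<Longrightarrow> f2 y \<notin> V"
    by (rule moved_nbhd[OF f2(1,5,6) U(1) f2(4)]) blast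
  obtain f1 x1 where f1: "f1 \<in> carrier G" "supp f1 \<subseteq> V" "x1 \<in> supp f1" "x1 \<in> V" "x1 \<in> X" "f1 x1 \<noteq> x1" "f1 \<noteq> \<one>"
    by (rule nontrivial_in[OF V(1) _ V(4)]) (use V(2) in blast)+
  define k2 where "k2 = commutator f2 h"
  define k where "k = commutator f1 k2"
  have cl: "k2 \<in> carrier G" "k \<in> carrier G"
    using f1 f2 h by (auto simp: k_def k2_def)
  \<comment> \<open>On \<open>V\<close> the factor \<open>h \<otimes> inv f2 \<otimes> inv h\<close>
    of the commutator is the identity, since \<open>inv h\<close> carries \<open>U\<close> off
    \<open>U\<close>.\<close>
  have k2V: "k2 y = f2 y" if "y \<in> V" for y
  proof -
    have y: "y \<in> X" "y \<in> U"
      using that V by auto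
    then have "(inv h) y \<notin> U"
      using U(5)[of "(inv h) y"] h by auto
    then have "(inv f2) ((inv h) y) = (inv h) y"
      using f2 h y by (intro not_supp) auto
    then show ?thesis
      using f2 h y by (simp add: k2_def commutator_def)
  qed
  have k_eq: "k = f1 \<otimes> (k2 \<otimes> inv f1 \<otimes> inv k2)"
    using f1 cl by (simp add: k_def commutator_def m_assoc)
  have "supp (k2 \<otimes> inv f1 \<otimes> inv k2) = k2 ` supp f1"
    using f1 cl by (simp add: supp_conj)
  also have "\<dots> = f2 ` supp f1"
    using k2V f1 by (intro image_cong) auto
  finally have s: "supp (k2 \<otimes> inv f1 \<otimes> inv k2) = f2 ` supp f1" .
  have "f2 ` U \<subseteq> U"
  proof clarify
    fix y assume "y \<in> U"
    then show "f2 y \<in> U"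
      using f2 U supp_act_closed[of f2 y] not_supp[of y f2] by (metis subset_iff)
  qed
  then have "supp f1 \<union> f2 ` supp f1 \<subseteq> U"
    using f1(2) V(3) by blast
  then have "supp k \<subseteq> U"
    using supp_mult[of f1 "k2 \<otimes> inv f1 \<otimes> inv k2"] f1 cl s unfolding k_eq by (simp add: subset_trans)
  then have comm: "k \<otimes> g = g \<otimes> k"
    using disj U cl g by (intro commute_if_disjoint) auto
  have "x1 \<notin> f2 ` supp f1"
    using V f1 by auto
  then have "(k2 \<otimes> inv f1 \<otimes> inv k2) x1 = x1"
    using s f1 by (intro not_supp) auto
  then have "k x1 = f1 x1"
    unfolding k_eq using f1 cl by (subst act_mult) auto
  then have "k \<noteq> \<one>"
    using f1 by auto
  moreover have "f1 \<otimes> g = g \<otimes> f1" "f2 \<otimes> g = g \<otimes> f2"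
    using commute_if_disjoint[OF f1(1) g] commute_if_disjoint[OF f2(1) g] disj U(3) V(3) f1(2) f2(2)
    by blast+
  ultimately show "\<exists>f1\<in>carrier G. \<exists>f2\<in>carrier G. f1 \<otimes> g = g \<otimes> f1 \<and> f2 \<otimes> g = g \<otimes> f2 \<and>
      commutator f1 (commutator f2 h) \<noteq> \<one> \<and>
      commutator f1 (commutator f2 h) \<otimes> g = g \<otimes> commutator f1 (commutator f2 h)"
    using f1 f2 comm by (auto simp: k_def k2_def)
qed

lemma pow_act_Suc: "g \<in> carrier G \<Longrightarrow> x \<in> X \<Longrightarrow> (g [^] Suc n) x = g ((g [^] (n::nat)) x)"
  by (metis act_mult nat_pow_Suc2 nat_pow_closed)

lemma pow_act_add: "g \<in> carrier G \<Longrightarrow> x \<in> X \<Longrightarrow> (g [^] (m + n::nat)) x = (g [^] m) ((g [^] n) x)"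
  by (metis act_mult nat_pow_closed nat_pow_mult)

lemma pow_act_fix:
  assumes "g \<in> carrier G" "x \<in> X" "(g [^] (d::nat)) x = x"
  shows "(g [^] (d * n)) x = x"
  by (induction n) (use assms in \<open>auto simp: pow_act_add\<close>)

lemma pow_commute:
  assumes "a \<in> carrier G" "g \<in> carrier G" "a \<otimes> g = g \<otimes> a"
  shows "a \<otimes> g [^] (n::nat) = g [^] n \<otimes> a"
proof (induction n)
  case (Suc n)
  have "a \<otimes> g [^] Suc n = (g [^] n \<otimes> a) \<otimes> g"
    using assms Suc by (simp flip: m_assoc)
  also have "\<dots> = g [^] Suc n \<otimes> a"
    using assms by (simp add: m_assoc)
  finally show ?case .
qed (use assms in auto)

text \<open>
  The exponent 12 is a common multiple of 1, 2, 3, 4: a point moved by \<open>g\<^sup>1\<^sup>2\<close> has at least five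
  distinct iterates, while an iterated commutator of \<open>h\<close> lives on only four translates of the
  support of \<open>h\<close>.
\<close>

lemma disjoint_if_alg_disjoint:
  assumes f: "f \<in> carrier G" and g: "g \<in> carrier G" and disj: "alg_disjoint f g"
  shows "supp f \<inter> supp (g [^] (12::nat)) = {}"
proof (rule ccontr)
  assume "supp f \<inter> supp (g [^] (12::nat)) \<noteq> {}"
  then obtain x where x: "x \<in> X" "f x \<noteq> x" "(g [^] (12::nat)) x \<noteq> x"
    by (auto simp: supp_def)
  have gx: "(g [^] d) x \<noteq> x" if "d \<in> {1,2,3,4}" for d :: nat
  proof
    assume "(g [^] d) x = x"
    moreover have "d dvd 12"
      using that by auto
    ultimately show False
      using pow_act_fix[OF g x(1)] x(3) by (metis dvdE)
  qed
  obtain U0 where U0: "open U0" "x \<in> U0" "U0 \<subseteq> X" "\<And>y. y \<in> U0 \<Longrightarrow> f y \<notin> U0"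
    using moved_nbhd[OF f x(1,2) open_UNIV] by (metis UNIV_I)
  have "\<forall>d::nat. \<exists>A. d \<in> {1,2,3,4} \<longrightarrow> open A \<and> x \<in> A \<and> (\<forall>y\<in>A. (g [^] d) y \<notin> A)"
  proof (intro allI)
    fix d :: nat
    show "\<exists>A. d \<in> {1,2,3,4} \<longrightarrow> open A \<and> x \<in> A \<and> (\<forall>y\<in>A. (g [^] d) y \<notin> A)"
    proof (cases "d \<in> {1,2,3,4}")
      case True
      show ?thesis
        by (rule moved_nbhd[OF nat_pow_closed[OF g] x(1) gx[OF True] open_UNIV UNIV_I]) blast
    qed blast
  qed
  then obtain A where A: "\<And>d::nat. d \<in> {1,2,3,4} \<Longrightarrow> open (A d) \<and> x \<in> A d \<and> (\<forall>y\<in>A d. (g [^] d) y \<notin> A d)"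
    by metis
  define U where "U = U0 \<inter> (\<Inter>d\<in>{1,2,3,4}. A d)"
  have U: "open U" "x \<in> U" "U \<subseteq> X"
    using U0 A unfolding U_def by (auto intro!: open_Int open_INT)
  have fU: "f y \<notin> U" if "y \<in> U" for y
    using U0 that by (auto simp: U_def)
  have gU: "(g [^] d) y \<notin> U" if "y \<in> U" "d \<in> {1,2,3,4}" for y and d :: nat
    using A[OF that(2)] that by (auto simp: U_def)
  obtain h x0 where h: "h \<in> carrier G" "supp h \<subseteq> U" "x0 \<in> supp h" "x0 \<in> U" "x0 \<in> X" "h x0 \<noteq> x0" "h \<noteq> \<one>"
    by (rule nontrivial_in[OF U(1) _ U(3)]) (use U(2) in blast)+
  \<comment> \<open>\<open>f\<close> carries \<open>x0\<close> out of \<open>U\<close>, where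
    \<open>h\<close> does nothing, while \<open>h\<close> moves \<open>x0\<close>.\<close>
  have "f \<otimes> h \<noteq> h \<otimes> f"
  proof
    assume "f \<otimes> h = h \<otimes> f"
    then have "f (h x0) = h (f x0)"
      using f h by (simp flip: act_mult)
    also have "\<dots> = f x0"
      using f h fU[of x0] by (intro not_supp) auto
    finally show False
      using f h by (simp add: act_inj)
  qed
  then obtain f1 f2 where f12: "f1 \<in> carrier G" "f2 \<in> carrier G" "f1 \<otimes> g = g \<otimes> f1"
      "f2 \<otimes> g = g \<otimes> f2" "commutator f1 (commutator f2 h) \<noteq> \<one>"
      "commutator f1 (commutator f2 h) \<otimes> g = g \<otimes> commutator f1 (commutator f2 h)"
    using disj h unfolding alg_disjoint_def by blast
  define k2 where "k2 = commutator f2 h"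
  define k where "k = commutator f1 k2"
  have cl: "k2 \<in> carrier G" "k \<in> carrier G"
    using f12 h by (auto simp: k_def k2_def)
  \<comment> \<open>Each of the two commutators doubles the number of translates of \<open>U\<close>
    that may carry the support, from one to four; the four translating elements commute with
    \<open>g\<close>.\<close>
  define A where "A = {\<one>, f1, f2, f1 \<otimes> f2}"
  have A: "a \<in> carrier G" "a \<otimes> g = g \<otimes> a" if "a \<in> A" for a
  proof -
    show "a \<in> carrier G"
      using that f12 by (auto simp: A_def)
    have "f1 \<otimes> f2 \<otimes> g = g \<otimes> (f1 \<otimes> f2)"
      using f12 g by (metis m_assoc)
    then show "a \<otimes> g = g \<otimes> a"
      using that f12 g by (auto simp: A_def)
  qed
  have "supp k2 \<subseteq> f2 ` supp h \<union> supp h"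
    using supp_mult[of "f2 \<otimes> h \<otimes> inv f2" "inv h"] f12 h by (simp add: k2_def commutator_def supp_conj)
  then have k2: "supp k2 \<subseteq> f2 ` U \<union> U"
    using h by auto
  have "supp k \<subseteq> f1 ` supp k2 \<union> supp k2"
    using supp_mult[of "f1 \<otimes> k2 \<otimes> inv f1" "inv k2"] f12 cl by (simp add: k_def commutator_def supp_conj)
  also have "\<dots> \<subseteq> f1 ` (f2 ` U \<union> U) \<union> (f2 ` U \<union> U)"
    using k2 by auto
  also have "\<dots> \<subseteq> (\<Union>a\<in>A. a ` U)"
  proof -
    have "(f1 \<otimes> f2) ` U = f1 ` f2 ` U" "\<one> ` U = U"
      using U f12 by (auto simp: image_image subset_iff intro!: image_cong)
    then show ?thesis
      by (auto simp: A_def image_Un)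
  qed
  finally have k: "supp k \<subseteq> (\<Union>a\<in>A. a ` U)" .
  obtain y where y: "y \<in> supp k"
    using f12(5) supp_empty_iff[of k] cl unfolding k_def k2_def by blast
  have yX: "y \<in> X"
    using y supp_subset by auto
  \<comment> \<open>\<open>k\<close> commutes with \<open>g\<close>, so \<open>supp k\<close>
    contains the forward orbit of \<open>y\<close> under \<open>g\<close>.\<close>
  have "(g [^] i) y \<in> supp k" for i :: nat
    using supp_commute[of k "g [^] i" y] pow_commute[of k g i] f12 cl g y by (simp add: k_def k2_def)
  then have "\<forall>i::nat. \<exists>a. a \<in> A \<and> (g [^] i) y \<in> a ` U"
    using k by blast
  then obtain a where a: "\<And>i::nat. a i \<in> A" "\<And>i::nat. (g [^] i) y \<in> a i ` U"
    by metis
  have "\<not> inj_on a {0..<5::nat}"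
  proof
    assume "inj_on a {0..<5::nat}"
    then have "card {0..<5::nat} \<le> card A"
      using a by (intro card_inj_on_le) (auto simp: A_def)
    also have "\<dots> \<le> 4"
      using card_length[of "[\<one>, f1, f2, f1 \<otimes> f2]"] by (simp add: A_def)
    finally show False
      by simp
  qed
  then obtain i j where ij: "i < j" "j < 5" "a i = a j"
    unfolding inj_on_def by (metis atLeastLessThan_iff linorder_neqE_nat)
  obtain u where u: "u \<in> U" "(g [^] i) y = a i u"
    using a by blast
  obtain u' where u': "u' \<in> U" "(g [^] j) y = a i u'"
    using a ij by fastforce
  \<comment> \<open>\<open>a i\<close> commutes with the powers of \<open>g\<close> and can be
    cancelled: two iterates in one translate of \<open>U\<close> yield a point of \<open>U\<close>
    that \<open>g [^] d\<close> returns to \<open>U\<close>, with \<open>d\<close> between 1 and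
    4.\<close>
  define d where "d = j - i"
  have "a i u' = (g [^] (d + i)) y"
    using u' ij by (simp add: d_def)
  also have "\<dots> = (g [^] d) (a i u)"
    using u g yX by (simp add: pow_act_add)
  also have "\<dots> = (g [^] d \<otimes> a i) u"
    using A a g u U by (subst act_mult) auto
  also have "\<dots> = a i ((g [^] d) u)"
    using pow_commute[OF A(1)[OF a(1)] g A(2)[OF a(1)], of i d] A(1)[OF a(1), of i] g u(1) U(3)
    by (simp flip: act_mult add: subset_iff)
  finally have "u' = (g [^] d) u"
  proof -
    have "(g [^] d) u \<in> X" "u' \<in> X"
      using g u(1) u'(1) U(3) by auto
    then show "a i u' = a i ((g [^] d) u) \<Longrightarrow> u' = (g [^] d) u"
      using act_inj[OF A(1)[OF a(1)[of i]]] by blast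
  qed
  moreover have "d = 1 \<or> d = 2 \<or> d = 3 \<or> d = 4"
    using ij(1,2) unfolding d_def by linarith
  ultimately show False
    using gU[OF u(1), of d] u'(1) by auto
qed

text \<open>A point of \<open>supp f\<close> outside \<open>closure (supp f')\<close> has a
  neighbourhood carrying some \<open>g\<close> disjoint from \<open>f'\<close> whose twelfth power
  does not commute with \<open>f\<close>. The closure is unavoidable: an open set that misses
  \<open>supp f'\<close>, such as a support, misses its closure too.\<close>

lemma below_iff:
  assumes f: "f \<in> carrier G" and f': "f' \<in> carrier G"
  shows "below f f' \<longleftrightarrow> supp f \<subseteq> closure (supp f')"
proof
  assume b: "below f f'"
  show "supp f \<subseteq> closure (supp f')"
  proof (rule ccontr)
    assume "\<not> supp f \<subseteq> closure (supp f')"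
    then obtain x where x: "x \<in> supp f" "x \<in> - closure (supp f')"
      by auto
    then obtain U where U: "open U" "x \<in> U" "U \<subseteq> - closure (supp f')" "U \<subseteq> X" "\<And>y. y \<in> U \<Longrightarrow> f y \<notin> U"
      using moved_nbhd[OF f, of x "- closure (supp f')"] by (auto simp: supp_def)
    obtain g where g: "g \<in> carrier G" "supp g \<subseteq> U" "g [^] (12::nat) \<noteq> \<one>"
      using small_support[of U] U by (auto simp: supp_def)
    then have "alg_disjoint f' g"
      using U f' closure_subset[of "supp f'"] by (intro alg_disjoint_if_disjoint) auto
    then have c: "f \<otimes> g [^] (12::nat) = g [^] (12::nat) \<otimes> f"
      using b g by (auto simp: below_def)
    have fix_outside: "(g [^] n) y = y" if "y \<in> X" "y \<notin> U" for n :: nat and y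
    proof (induction n)
      case (Suc n)
      then show ?case
        using that g not_supp[of y g] by (subst pow_act_Suc) auto
    qed (use that in simp)
    obtain y where y: "y \<in> X" "(g [^] (12::nat)) y \<noteq> y"
      using g act_eqI[of "g [^] (12::nat)" \<one>] by auto
    then have "y \<in> U"
      using fix_outside by blast
    have "f ((g [^] (12::nat)) y) = (g [^] (12::nat)) (f y)"
      using c f g y by (metis act_mult nat_pow_closed)
    also have "\<dots> = f y"
      using fix_outside f y U \<open>y \<in> U\<close> by simp
    finally show False
      using f g y by (simp add: act_inj)
  qed
next
  assume s: "supp f \<subseteq> closure (supp f')"
  show "below f f'"
    unfolding below_def
  proof (intro ballI impI)
    fix g assume g: "g \<in> carrier G" "alg_disjoint f' g"
    then have "supp (g [^] (12::nat)) \<inter> supp f' = {}"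
      using disjoint_if_alg_disjoint f' by blast
    then have "supp (g [^] (12::nat)) \<inter> closure (supp f') = {}"
      using g by (subst open_Int_closure_eq_empty) (auto intro: supp_open)
    then show "f \<otimes> g [^] (12::nat) = g [^] (12::nat) \<otimes> f"
      using s f g by (intro commute_if_disjoint) auto
  qed
qed

text \<open>Closures of disjoint open sets may meet, but their intersection contains no nonempty
  open set, and supports are open.\<close>

lemma separated_iff:
  assumes f: "f \<in> carrier G" and f': "f' \<in> carrier G"
  shows "separated f f' \<longleftrightarrow> supp f \<inter> supp f' = {}"
proof
  assume s: "separated f f'"
  show "supp f \<inter> supp f' = {}"
  proof (rule ccontr)
    assume ne: "supp f \<inter> supp f' \<noteq> {}"
    have "open (supp f \<inter> supp f')" "supp f \<inter> supp f' \<subseteq> X"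
      using supp_open[OF f] supp_open[OF f'] supp_subset[of f] by auto
    then obtain g where "g \<in> carrier G" "supp g \<subseteq> supp f \<inter> supp f'" "g \<noteq> \<one>"
      using nontrivial_in[OF _ ne] by metis
    then show False
      using s below_iff[of g f] below_iff[of g f'] f f' closure_subset[of "supp f"]
        closure_subset[of "supp f'"]
      unfolding separated_def by blast
  qed
next
  assume s: "supp f \<inter> supp f' = {}"
  show "separated f f'"
    unfolding separated_def
  proof (intro ballI impI)
    fix w assume w: "w \<in> carrier G" "below w f \<and> below w f'"
    then have "supp w \<subseteq> closure (supp f)" "supp w \<subseteq> closure (supp f')"
      using f f' by (auto simp: below_iff)
    moreover have "open (supp w)" "open (supp f)"
      using w f supp_open by auto
    moreover have "supp f \<inter> closure (supp f') = {}"
      using s f by (subst open_Int_closure_eq_empty) (auto intro: supp_open)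
    ultimately have "supp w = {}"
      using open_Int_closure_eq_empty[of "supp w" "supp f"] by blast
    then show "w = \<one>"
      using w supp_empty_iff by auto
  qed
qed

end

section \<open>Reconstruction of points\<close>

text \<open>\<open>escape\<close> stands in for local compactness: it holds vacuously when
  \<open>closure W\<close> is compact, for then the closures of the \<open>Z i\<close> have a common
  point. \<open>point_base\<close> gives each point a countable neighbourhood base of
  supports.\<close>

locale locally_moving = small_supports +
  assumes locally_transitive: "\<And>U x. open U \<Longrightarrow> U \<subseteq> X \<Longrightarrow> x \<in> U \<Longrightarrow>
      \<exists>W. open W \<and> x \<in> W \<and> W \<subseteq> U \<and> (\<forall>y\<in>W. \<exists>g\<in>carrier G. supp g \<subseteq> U \<and> g x = y)"
    and escape: "\<And>p. p \<in> X \<Longrightarrow> \<exists>W. open W \<and> p \<in> W \<and> closure W \<subseteq> X \<and>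
      (\<forall>Z. (\<forall>i. open (Z i) \<and> Z i \<noteq> {} \<and> Z i \<subseteq> closure W \<and> closure (Z (Suc i)) \<subseteq> closure (Z i)) \<and>
          (\<Inter>i::nat. closure (Z i)) = {} \<longrightarrow>
        (\<exists>h\<in>carrier G. \<forall>i. (\<exists>z\<in>Z i. h z = z) \<and> (\<exists>z\<in>Z i. h z \<notin> closure W)))"
    and point_base: "\<And>x. x \<in> X \<Longrightarrow> \<exists>f. (\<forall>k::nat. f k \<in> carrier G \<and> x \<in> supp (f k) \<and>
        supp (f (Suc k)) \<subseteq> supp (f k)) \<and> (\<forall>U. open U \<and> x \<in> U \<longrightarrow> (\<exists>k. closure (supp (f k)) \<subseteq> U))"
begin

text \<open>The group determines only the closure of \<open>supp f\<close>. The region is the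
  largest open set with that closure, and it turns \<open>below\<close> into an inclusion.\<close>

definition region :: "('a \<Rightarrow> 'a) \<Rightarrow> 'a set" where
  "region f = interior (closure (supp f))"

definition converges :: "(nat \<Rightarrow> 'a \<Rightarrow> 'a) \<Rightarrow> 'a \<Rightarrow> bool" where
  "converges f x \<longleftrightarrow> (\<forall>k. x \<in> region (f k)) \<and> (\<forall>U. open U \<and> x \<in> U \<longrightarrow> (\<exists>k. supp (f k) \<subseteq> U))"

lemma open_region: "open (region f)"
  by (simp add: region_def)

lemma supp_subset_region: "f \<in> carrier G \<Longrightarrow> supp f \<subseteq> region f"
  unfolding region_def by (rule interior_maximal[OF closure_subset supp_open])

lemma region_subset: "region f \<subseteq> closure (supp f)"
  by (simp add: region_def interior_subset)

lemma below_iff_region: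
  assumes "f \<in> carrier G" "f' \<in> carrier G"
  shows "below f f' \<longleftrightarrow> supp f \<subseteq> region f'"
  unfolding below_iff[OF assms] region_def
  using assms(1) by (meson interior_maximal interior_subset order_trans supp_open)

lemma below_region_mono:
  assumes "f \<in> carrier G" "f' \<in> carrier G" "below f f'"
  shows "region f \<subseteq> region f'"
  unfolding region_def
  by (intro interior_mono closure_minimal closed_closure) (use assms below_iff in auto)

lemma supp_conj_by: "g \<in> carrier G \<Longrightarrow> f \<in> carrier G \<Longrightarrow> supp (conj_by g f) = g ` supp f"
  by (simp add: conj_by_def supp_conj)

text \<open>Closures are formed in the ambient space, while \<open>g\<close> is continuous only on
  \<open>X\<close>; hence the restriction to \<open>z \<in> X\<close>.\<close>

lemma act_closure:
  assumes g: "g \<in> carrier G" and "A \<subseteq> X" "z \<in> X" "z \<in> closure A"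
  shows "g z \<in> closure (g ` A)"
proof (rule ccontr)
  assume "g z \<notin> closure (g ` A)"
  then have "open {x\<in>X. g x \<in> - closure (g ` A)}" "z \<in> {x\<in>X. g x \<in> - closure (g ` A)}"
    using assms open_vimage_act[OF g, of "- closure (g ` A)"] by (auto simp: open_Compl)
  then have "{x\<in>X. g x \<in> - closure (g ` A)} \<inter> A \<noteq> {}"
    using \<open>z \<in> closure A\<close> by (metis (no_types, lifting) disjoint_iff open_Int_closure_eq_empty)
  then show False
    using closure_subset[of "g ` A"] by auto
qed

lemma conj_by_inv:
  assumes "g \<in> carrier G" "f \<in> carrier G"
  shows "conj_by (inv g) (conj_by g f) = f"
  using assms by (simp add: conj_by_def m_assoc) (simp flip: m_assoc)

text \<open>A region may reach beyond \<open>X\<close>, where \<open>g\<close> is not controlled.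
  Its part inside \<open>X\<close> is open and has an open image inside the closure of the
  conjugated support.\<close>

lemma region_conj_by1:
  assumes g: "g \<in> carrier G" "f \<in> carrier G" "x \<in> X" "x \<in> region f"
  shows "g x \<in> region (conj_by g f)"
proof -
  have "g ` (region f \<inter> X) \<subseteq> closure (g ` supp f)"
    using g act_closure[OF g(1) supp_subset] region_subset by blast
  moreover have "open (g ` (region f \<inter> X))"
    by (intro open_image_act g open_Int open_region open_X) auto
  ultimately have "g ` (region f \<inter> X) \<subseteq> region (conj_by g f)"
    using g by (simp add: region_def supp_conj_by interior_maximal)
  then show ?thesis
    using g by blast
qed

lemma region_conj_by:
  assumes g: "g \<in> carrier G" "f \<in> carrier G" "x \<in> X"
  shows "g x \<in> region (conj_by g f) \<longleftrightarrow> x \<in> region f"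
  using region_conj_by1[OF g] region_conj_by1[of "inv g" "conj_by g f" "g x"] g
  by (auto simp: conj_by_inv)

text \<open>A nontrivial element supported in \<open>{x}\<close> would have to move \<open>x\<close>
  to another point of its own support.\<close>

lemma not_open_singleton: "x \<in> X \<Longrightarrow> \<not> open {x}"
proof
  assume "x \<in> X" "open {x}"
  then obtain g y where g: "g \<in> carrier G" "supp g \<subseteq> {x}" "y \<in> supp g" "y \<in> {x}" "y \<in> X" "g y \<noteq> y" "g \<noteq> \<one>"
    using nontrivial_in[of "{x}"] by blast
  then show False
    using supp_act_closed[of g y] by auto
qed

lemma other_point:
  assumes "open U" "U \<subseteq> X" "U \<noteq> {}"
  obtains y where "y \<in> U" "y \<noteq> x"
  using assms not_open_singleton by (metis insertI1 subsetD subset_singletonD subsetI singletonI)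

lemma converges_unique:
  assumes "converges f x" "x \<in> X" "y \<in> X" "\<And>k. y \<in> closure (supp (f k))"
  shows "y = x"
proof (rule ccontr)
  assume "y \<noteq> x"
  then obtain U V where UV: "open U" "open V" "x \<in> U" "y \<in> V" "U \<inter> V = {}"
    using hausdorff_X assms unfolding hausdorff_on_def by metis
  then obtain k where "supp (f k) \<subseteq> U"
    using assms by (auto simp: converges_def)
  then have "V \<inter> closure (supp (f k)) = {}"
    using UV by (subst open_Int_closure_eq_empty) auto
  then show False
    using UV assms by blast
qed

text \<open>The right-hand side is purely algebraic; this is how membership of a limit in a region
  passes through an isomorphism.\<close>

lemma converges_below_iff:
  assumes "\<And>k. f k \<in> carrier G" "converges f x" "g \<in> carrier G"
  shows "x \<in> region g \<longleftrightarrow> (\<exists>k. below (f k) g)"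
proof
  assume "x \<in> region g"
  then show "\<exists>k. below (f k) g"
    using assms open_region by (auto simp: below_iff_region converges_def)
next
  assume "\<exists>k. below (f k) g"
  then show "x \<in> region g"
    using below_region_mono assms unfolding converges_def by blast
qed

lemma small_region:
  assumes "x \<in> X" "open U" "x \<in> U"
  obtains g where "g \<in> carrier G" "x \<in> region g" "region g \<subseteq> U"
  using point_base[OF assms(1)] assms(2,3) supp_subset_region region_subset
  by (metis subsetD subset_trans)

lemma regions_separate:
  assumes "x \<in> X" "y \<in> X" "\<And>g. g \<in> carrier G \<Longrightarrow> x \<in> region g \<longleftrightarrow> y \<in> region g"
  shows "x = y"
proof (rule ccontr)
  assume "x \<noteq> y"
  then obtain U V where "open U" "x \<in> U" "y \<notin> U"
    using hausdorff_X assms unfolding hausdorff_on_def by (metis disjoint_iff)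
  then show False
    using small_region[of x U] assms by blast
qed

section \<open>Point sequences are the convergent ones\<close>

lemma point_seq_if_converges:
  assumes f: "\<And>k. f k \<in> carrier G" and dec: "\<And>k. below (f (Suc k)) (f k)"
    and x: "x \<in> X" and conv: "converges f x"
  shows "point_seq f"
  unfolding point_seq_def
proof (intro conjI allI ballI impI)
  fix k
  show "f k \<in> carrier G" "below (f (Suc k)) (f k)"
    using f dec by auto
  have xk: "x \<in> region (f k)"
    using conv by (auto simp: converges_def)
  then show "f k \<noteq> \<one>"
    using supp_empty_iff[OF f, of k] by (auto simp: region_def)
  obtain W where W: "open W" "x \<in> W" "W \<subseteq> region (f k) \<inter> X"
      "\<And>y. y \<in> W \<Longrightarrow> \<exists>g\<in>carrier G. supp g \<subseteq> region (f k) \<inter> X \<and> g x = y"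
    using locally_transitive[of "region (f k) \<inter> X" x] xk x open_region[of "f k"] open_X
    by (metis IntI Int_lower2 open_Int)
  obtain j where j: "supp (f j) \<subseteq> W"
    using W conv by (auto simp: converges_def)
  show "\<exists>j. \<forall>w\<in>carrier G. w \<noteq> \<one> \<longrightarrow> below w (f j) \<longrightarrow>
          (\<exists>g\<in>carrier G. below g (f k) \<and> (\<exists>m. below (conj_by g (f m)) w))"
  proof (intro exI ballI impI)
    fix w assume w: "w \<in> carrier G" "w \<noteq> \<one>" "below w (f j)"
    \<comment> \<open>\<open>below\<close> gives containment in a closure only; being open,
      \<open>supp w\<close> nevertheless meets \<open>supp (f j)\<close> itself, and thus
      \<open>W\<close>.\<close>
    have "supp w \<noteq> {}" "supp w \<subseteq> closure (supp (f j))"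
      using w f supp_empty_iff below_iff by auto
    then have "supp w \<inter> supp (f j) \<noteq> {}"
      using open_Int_closure_eq_empty[OF supp_open[OF w(1)], of "supp (f j)"] by blast
    then obtain y where y: "y \<in> supp w" "y \<in> W"
      using j by blast
    then obtain g where g: "g \<in> carrier G" "supp g \<subseteq> region (f k) \<inter> X" "g x = y"
      using W by blast
    have "open {z\<in>X. g z \<in> supp w}" "x \<in> {z\<in>X. g z \<in> supp w}"
      using open_vimage_act g supp_open w x y by auto
    then obtain m where "supp (f m) \<subseteq> {z\<in>X. g z \<in> supp w}"
      using conv unfolding converges_def by meson
    then have "below (conj_by g (f m)) w"
      using g f w closure_subset[of "supp w"] by (auto simp: below_iff supp_conj_by)
    moreover have "below g (f k)"
      using g f by (auto simp: below_iff_region)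
    ultimately show "\<exists>g\<in>carrier G. below g (f k) \<and> (\<exists>m. below (conj_by g (f m)) w)"
      using g by blast
  qed
next
  fix w assume w: "w \<in> carrier G" "\<forall>k. below w (f k)"
  then have sub: "supp w \<subseteq> {x}"
    using converges_unique[OF conv x] f supp_subset by (fastforce simp: below_iff)
  have "supp w \<noteq> {x}"
    using not_open_singleton[OF x] supp_open[OF w(1)] by auto
  then show "w = \<one>"
    using sub supp_empty_iff[OF w(1)] by blast
next
  fix g assume g: "g \<in> carrier G"
  show "(\<exists>k. separated (conj_by g (f k)) (f k)) \<or> (\<forall>k. \<exists>j. below (conj_by g (f j)) (f k))"
  \<comment> \<open>If \<open>g\<close> fixes the limit, continuity sends late supports into any
    given region; if not, some support lies in a neighbourhood of \<open>x\<close> that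
    \<open>g\<close> moves off itself.\<close>
  proof (cases "g x = x")
    case True
    have "\<exists>j. below (conj_by g (f j)) (f k)" for k
    proof -
      have "open {z\<in>X. g z \<in> region (f k)}" "x \<in> {z\<in>X. g z \<in> region (f k)}"
        using open_vimage_act[OF g open_region] x True conv by (auto simp: converges_def)
      then obtain j where "supp (f j) \<subseteq> {z\<in>X. g z \<in> region (f k)}"
        using conv unfolding converges_def by meson
      then have "below (conj_by g (f j)) (f k)"
        using g f by (auto simp: below_iff_region supp_conj_by)
      then show ?thesis ..
    qed
    then show ?thesis by blast
  next
    case False
    obtain U where U: "open U" "x \<in> U" "U \<subseteq> UNIV" "U \<subseteq> X" "\<And>y. y \<in> U \<Longrightarrow> g y \<notin> U"
      by (rule moved_nbhd[OF g x False open_UNIV UNIV_I]) blast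
    then obtain k where "supp (f k) \<subseteq> U"
      using conv unfolding converges_def by meson
    then have "g ` supp (f k) \<inter> supp (f k) = {}"
      using U(5) by blast
    then have "separated (conj_by g (f k)) (f k)"
      using g f by (auto simp: separated_iff supp_conj_by)
    then show ?thesis by blast
  qed
qed

text \<open>The points of \<open>X\<close> adherent to every support form a set \<open>N\<close>,
  without interior by the second clause. If \<open>N\<close> were empty, \<open>escape\<close> would
  contradict the last clause. If the supports did not shrink to a point \<open>x\<close> of
  \<open>N\<close>, elements supported near \<open>x\<close> would fix a point of every support, the
  last clause would make them carry \<open>x\<close> into \<open>N\<close>, and by local
  transitivity \<open>N\<close> would contain a neighbourhood of \<open>x\<close>.\<close>

lemma converges_if_point_seq:
  assumes ps: "point_seq f"
  shows "\<exists>x\<in>X. converges f x"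
proof -
  have f: "f k \<in> carrier G" and f1: "f k \<noteq> \<one>" and dec: "below (f (Suc k)) (f k)" for k
    using ps by (auto simp: point_seq_def)
  have meet: "w = \<one>" if "w \<in> carrier G" "\<And>k. below w (f k)" for w
    using ps that unfolding point_seq_def by blast
  have shrink: "\<exists>j. \<forall>w\<in>carrier G. w \<noteq> \<one> \<longrightarrow> below w (f j) \<longrightarrow>
      (\<exists>g\<in>carrier G. below g (f k) \<and> (\<exists>m. below (conj_by g (f m)) w))" for k
    using ps unfolding point_seq_def by blast
  have anti: "closure (supp (f j)) \<subseteq> closure (supp (f i))" if "i \<le> j" for i j
    using that
  proof (induction rule: dec_induct)
    case (step n)
    have "closure (supp (f (Suc n))) \<subseteq> closure (supp (f n))"
      by (intro closure_minimal closed_closure) (use dec[of n] f below_iff in blast)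
    then show ?case
      using step by blast
  qed simp
  \<comment> \<open>Separation at one stage would persist at all later ones, because disjoint open
    sets miss each other's closure. Images meeting at arbitrarily late stages thus leave only the
    second alternative of the last clause.\<close>
  have alt: "(\<forall>k. \<exists>j. g ` supp (f j) \<subseteq> closure (supp (f k)))"
    if g: "g \<in> carrier G" and meets: "\<And>k. \<exists>j\<ge>k. g ` supp (f j) \<inter> supp (f j) \<noteq> {}" for g
  proof -
    have "g ` supp (f k) \<inter> supp (f k) \<noteq> {}" for k
    proof
      assume disj: "g ` supp (f k) \<inter> supp (f k) = {}"
      obtain j where j: "j \<ge> k" "g ` supp (f j) \<inter> supp (f j) \<noteq> {}"
        using meets by blast
      have sub: "supp (f j) \<subseteq> closure (supp (f k)) \<inter> X"
        using anti[OF j(1)] closure_subset[of "supp (f j)"] supp_subset[of "f j"] by blast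
      have "g ` supp (f k) \<inter> closure (supp (f k)) = {}"
        using disj g f by (subst open_Int_closure_eq_empty) (auto intro!: open_image_act supp_open supp_subset)
      then have "supp (f j) \<inter> g ` supp (f k) = {}"
        using sub by blast
      then have "supp (f j) \<inter> closure (g ` supp (f k)) = {}"
        using f by (subst open_Int_closure_eq_empty) (auto intro!: supp_open)
      moreover have "g ` supp (f j) \<subseteq> closure (g ` supp (f k))"
        using act_closure[OF g supp_subset] sub by blast
      ultimately show False
        using j by blast
    qed
    then have "\<not> separated (conj_by g (f k)) (f k)" for k
      using g f by (simp add: separated_iff supp_conj_by)
    then have "\<forall>k. \<exists>j. below (conj_by g (f j)) (f k)"
      using ps g(1) unfolding point_seq_def by blast
    then show ?thesis
      using g f by (simp add: below_iff supp_conj_by)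
  qed
  define N where "N = (\<Inter>k. closure (supp (f k))) \<inter> X"
  have N_open: False if T: "open T" "T \<noteq> {}" "T \<subseteq> N" for T
  proof -
    have "T \<subseteq> X"
      using T by (auto simp: N_def)
    then obtain w y where w: "w \<in> carrier G" "supp w \<subseteq> T" "y \<in> supp w" "y \<in> T" "y \<in> X" "w y \<noteq> y" "w \<noteq> \<one>"
      by (rule nontrivial_in[OF T(1,2)])
    then have "below w (f k)" for k
      using f[of k] w(1,2) T(3) by (auto simp: below_iff N_def)
    then show False
      using w meet by blast
  qed
  have "N \<noteq> {}"
  proof
    assume N: "N = {}"
    obtain j where j: "\<And>w. w \<in> carrier G \<Longrightarrow> w \<noteq> \<one> \<Longrightarrow> below w (f j) \<Longrightarrow>
      (\<exists>g\<in>carrier G. below g (f 0) \<and> (\<exists>m. below (conj_by g (f m)) w))"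
      using shrink by meson
    obtain p where p: "p \<in> supp (f j)" "p \<in> X"
      using f1 f supp_empty_iff supp_subset by (metis equals0I subsetD)
    obtain W where W: "open W" "p \<in> W" "closure W \<subseteq> X"
      "\<And>Z. (\<And>i. open (Z i) \<and> Z i \<noteq> {} \<and> Z i \<subseteq> closure W \<and> closure (Z (Suc i)) \<subseteq> closure (Z i)) \<Longrightarrow>
          (\<Inter>i::nat. closure (Z i)) = {} \<Longrightarrow>
        (\<exists>h\<in>carrier G. \<forall>i. (\<exists>z\<in>Z i. h z = z) \<and> (\<exists>z\<in>Z i. h z \<notin> closure W))"
      using escape[OF p(2)] by metis
    have Wj: "open (W \<inter> supp (f j))" "W \<inter> supp (f j) \<noteq> {}" "W \<inter> supp (f j) \<subseteq> X"
      using W p supp_open[OF f] supp_subset[of "f j"] by auto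
    obtain w y where w: "w \<in> carrier G" "supp w \<subseteq> W \<inter> supp (f j)" "y \<in> supp w" "y \<in> W \<inter> supp (f j)"
        "y \<in> X" "w y \<noteq> y" "w \<noteq> \<one>"
      by (rule nontrivial_in[OF Wj]) blast
    have "below w (f j)"
      using w f closure_subset[of "supp (f j)"] by (auto simp: below_iff)
    then obtain g m where g: "g \<in> carrier G" "below (conj_by g (f m)) w"
      using j w by blast
    have gm: "g ` supp (f m) \<subseteq> closure W"
    proof -
      have "g ` supp (f m) \<subseteq> closure (supp w)"
        using g f w by (simp add: below_iff supp_conj_by)
      also have "\<dots> \<subseteq> closure W"
        using w by (intro closure_mono) auto
      finally show ?thesis .
    qed
    define Z where "Z i = g ` supp (f (m + i))" for i
    have clZ: "g ` (closure (supp (f (m + i))) \<inter> X) \<subseteq> closure (Z i)" for i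
      using act_closure[OF g(1) supp_subset] unfolding Z_def by auto
    have ZW: "Z i \<subseteq> closure W" for i
    proof -
      have "supp (f (m + i)) \<subseteq> closure (supp (f m)) \<inter> X"
        using anti[of m "m + i"] closure_subset supp_subset by fastforce
      then have "Z i \<subseteq> closure (Z 0)"
        using clZ[of 0] by (auto simp: Z_def)
      also have "\<dots> \<subseteq> closure W"
        using gm by (intro closure_minimal) (auto simp: Z_def)
      finally show ?thesis .
    qed
    have Z1: "open (Z i) \<and> Z i \<noteq> {} \<and> Z i \<subseteq> closure W \<and> closure (Z (Suc i)) \<subseteq> closure (Z i)" for i
    proof (intro conjI)
      show "open (Z i)"
        unfolding Z_def by (intro open_image_act g supp_open f supp_subset)
      show "Z i \<noteq> {}"
        using f f1 supp_empty_iff by (auto simp: Z_def)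
      have "Z (Suc i) \<subseteq> closure (Z i)"
        using clZ[of i] anti[of "m + i" "m + Suc i"] closure_subset[of "supp (f (m + Suc i))"] supp_subset
        by (force simp: Z_def)
      then show "closure (Z (Suc i)) \<subseteq> closure (Z i)"
        by (intro closure_minimal) auto
    qed (rule ZW)
    \<comment> \<open>This uses \<open>closure W \<subseteq> X\<close>: a common adherent point of
      the \<open>Z i\<close> lies in \<open>X\<close>, so \<open>inv g\<close> takes it to a point
      of \<open>N\<close>.\<close>
    have Z2: "(\<Inter>i. closure (Z i)) = {}"
    proof (rule equals0I)
      fix z assume z: "z \<in> (\<Inter>i. closure (Z i))"
      have "closure (Z 0) \<subseteq> closure W"
        by (intro closure_minimal ZW closed_closure)
      then have "z \<in> X"
        using z W by blast
      have "(inv g) z \<in> closure (supp (f k))" for k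
      proof -
        have "(inv g) z \<in> closure ((inv g) ` Z k)"
          by (intro act_closure) (use g z \<open>z \<in> X\<close> ZW W in auto)
        also have "(inv g) ` Z k = supp (f (m + k))"
          unfolding Z_def image_image using g supp_subset by (force simp: image_iff)
        also have "closure \<dots> \<subseteq> closure (supp (f k))"
          by (rule anti) simp
        finally show ?thesis .
      qed
      moreover have "(inv g) z \<in> X"
        using \<open>z \<in> X\<close> g by simp
      ultimately show False
        using N unfolding N_def by blast
    qed
    obtain h where h: "h \<in> carrier G" "\<And>i. \<exists>z\<in>Z i. h z = z" "\<And>i. \<exists>z\<in>Z i. h z \<notin> closure W"
      using W(4)[of Z] Z1 Z2 by blast
    \<comment> \<open>Seen from the original sequence, the fixed points of \<open>h\<close> make
      every late support meet its image under \<open>h'\<close>, so the last clause puts the image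
      of some support into \<open>closure (supp (f m))\<close>; the points that \<open>h\<close>
      expels from \<open>closure W\<close> refute this.\<close>
    define h' where "h' = inv g \<otimes> h \<otimes> g"
    have h': "h' \<in> carrier G" "\<And>x. x \<in> X \<Longrightarrow> g (h' x) = h (g x)"
      using g h by (auto simp: h'_def)
    have "h' ` supp (f (m + k)) \<inter> supp (f (m + k)) \<noteq> {}" for k
    proof -
      obtain u where u: "u \<in> supp (f (m + k))" "h (g u) = g u"
        using h(2)[of k] by (auto simp: Z_def)
      then have "u \<in> X"
        using supp_subset by auto
      then have "h' u = u"
        using act_inj[OF g(1), of "h' u" u] h' u by auto
      then show ?thesis
        using u by force
    qed
    then have "\<exists>j\<ge>k. h' ` supp (f j) \<inter> supp (f j) \<noteq> {}" for k
      using le_add2 by blast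
    then obtain i where i: "h' ` supp (f i) \<subseteq> closure (supp (f m))"
      using alt[OF h'(1)] by blast
    obtain z where z: "z \<in> supp (f (m + i))" "h (g z) \<notin> closure W"
      using h(3)[of i] by (auto simp: Z_def)
    then have zX: "z \<in> X" "z \<in> closure (supp (f i))"
      using supp_subset anti[of i "m + i"] closure_subset[of "supp (f (m + i))"] by auto
    have "h' z \<in> closure (supp (f m))"
      using act_closure[OF h'(1) supp_subset zX] i closure_minimal by blast
    then have "g (h' z) \<in> closure (g ` supp (f m))"
      using act_closure[OF g(1) supp_subset, of "h' z" "f m"] h' zX by auto
    then show False
      using gm closure_minimal[OF gm closed_closure] z h' zX by auto
  qed
  then obtain x where x: "x \<in> X" "\<And>k. x \<in> closure (supp (f k))"
    by (auto simp: N_def)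
  have "\<exists>k. supp (f k) \<subseteq> U" if U: "open U" "x \<in> U" for U
  proof (rule ccontr)
    assume no: "\<not> (\<exists>k. supp (f k) \<subseteq> U)"
    obtain W where W: "open W" "x \<in> W" "W \<subseteq> U \<inter> X"
        "\<And>y. y \<in> W \<Longrightarrow> \<exists>g\<in>carrier G. supp g \<subseteq> U \<inter> X \<and> g x = y"
      using locally_transitive[of "U \<inter> X" x] U x open_X by (metis IntI Int_lower2 open_Int)
    have "W \<subseteq> N"
    proof
      fix y assume "y \<in> W"
      then obtain g where g: "g \<in> carrier G" "supp g \<subseteq> U \<inter> X" "g x = y"
        using W by blast
      have "g ` supp (f k) \<inter> supp (f k) \<noteq> {}" for k
      proof -
        obtain z where "z \<in> supp (f k)" "z \<notin> U"
          using no by blast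
        moreover have "g z = z"
          using calculation g supp_subset by (intro not_supp) auto
        ultimately show ?thesis
          by force
      qed
      then have "\<exists>j\<ge>k. g ` supp (f j) \<inter> supp (f j) \<noteq> {}" for k
        by blast
      then have "\<forall>k. \<exists>j. g ` supp (f j) \<subseteq> closure (supp (f k))"
        using alt[OF g(1)] by blast
      moreover have "g x \<in> closure (g ` supp (f j))" for j
        by (rule act_closure[OF g(1) supp_subset x])
      ultimately have "g x \<in> closure (supp (f k))" for k
        using closure_minimal[OF _ closed_closure] by blast
      then show "y \<in> N"
        using g x by (auto simp: N_def)
    qed
    then show False
      using N_open W by blast
  qed
  \<comment> \<open>An element below \<open>f k\<close> would fix an \<open>x\<close> outside
    \<open>region (f k)\<close>, so the conjugates of the \<open>f m\<close> by it would still
    adhere to \<open>x\<close>; but the third clause conjugates some \<open>f m\<close> in this way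
    into a support kept away from \<open>x\<close>.\<close>
  moreover have "x \<in> region (f k)" for k
  proof (rule ccontr)
    assume nx: "x \<notin> region (f k)"
    obtain j where j: "\<And>w. w \<in> carrier G \<Longrightarrow> w \<noteq> \<one> \<Longrightarrow> below w (f j) \<Longrightarrow>
      (\<exists>g\<in>carrier G. below g (f k) \<and> (\<exists>m. below (conj_by g (f m)) w))"
      using shrink by meson
    obtain y where y: "y \<in> supp (f j)" "y \<noteq> x"
      using other_point[of "supp (f j)" x] supp_open[OF f] supp_subset supp_empty_iff f f1 by metis
    then obtain U V where UV: "open U" "open V" "x \<in> U" "y \<in> V" "U \<inter> V = {}"
      using hausdorff_X x supp_subset unfolding hausdorff_on_def by (metis subsetD)
    have Vj: "open (V \<inter> supp (f j))" "V \<inter> supp (f j) \<noteq> {}" "V \<inter> supp (f j) \<subseteq> X"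
      using UV y supp_open[OF f] supp_subset[of "f j"] by auto
    obtain w z where w: "w \<in> carrier G" "supp w \<subseteq> V \<inter> supp (f j)" "z \<in> supp w" "z \<in> V \<inter> supp (f j)"
        "z \<in> X" "w z \<noteq> z" "w \<noteq> \<one>"
      by (rule nontrivial_in[OF Vj]) blast
    have "below w (f j)"
      using w f closure_subset[of "supp (f j)"] by (auto simp: below_iff)
    then obtain g m where g: "g \<in> carrier G" "below g (f k)" "below (conj_by g (f m)) w"
      using j w by blast
    have "x \<notin> supp g"
      using g f nx by (auto simp: below_iff_region)
    then have "g x = x"
      using x not_supp by auto
    then have "x \<in> closure (g ` supp (f m))"
      using act_closure[OF g(1) supp_subset x] by metis
    moreover have "g ` supp (f m) \<subseteq> closure (supp w)"
      using g f w by (simp add: below_iff supp_conj_by)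
    ultimately have "x \<in> closure (supp w)"
      using closure_minimal by blast
    moreover have "U \<inter> closure (supp w) = {}"
      using UV w by (subst open_Int_closure_eq_empty) auto
    ultimately show False
      using UV by blast
  qed
  ultimately show ?thesis
    using x by (auto simp: converges_def)
qed

end

section \<open>The homeomorphism induced by a group isomorphism\<close>

locale locally_moving_iso = G: locally_moving G X + H: locally_moving H Y + group_iso G H \<phi>
  for G :: "('a::topological_space \<Rightarrow> 'a) monoid" (structure) and X
    and H :: "('b::topological_space \<Rightarrow> 'b) monoid" (structure) and Y and \<phi>
begin

text \<open>Points are matched through all regions containing them, which makes the matching
  independent of the sequence chosen to represent a point.\<close>

definition corresponds :: "'a \<Rightarrow> 'b \<Rightarrow> bool" where
  "corresponds x y \<longleftrightarrow> x \<in> X \<and> y \<in> Y \<and> (\<forall>g\<in>carrier G. x \<in> G.region g \<longleftrightarrow> y \<in> H.region (\<phi> g))"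

lemma correspondsI:
  assumes f: "\<And>k. f k \<in> carrier G" and "x \<in> X" "y \<in> Y" "G.converges f x" "H.converges (\<lambda>k. \<phi> (f k)) y"
  shows "corresponds x y"
  unfolding corresponds_def
  using assms G.converges_below_iff[of f x] H.converges_below_iff[of "\<lambda>k. \<phi> (f k)" y]
  by (simp add: below_iso)

lemma ex_corresponds:
  assumes x: "x \<in> X"
  shows "\<exists>y. corresponds x y"
proof -
  obtain f where f: "\<And>k. f k \<in> carrier G" "\<And>k::nat. x \<in> G.supp (f k)"
    "\<And>k. G.supp (f (Suc k)) \<subseteq> G.supp (f k)"
    "\<And>U. open U \<Longrightarrow> x \<in> U \<Longrightarrow> \<exists>k. closure (G.supp (f k)) \<subseteq> U"
    using G.point_base[OF x] by metis
  have conv: "G.converges f x"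
    unfolding G.converges_def using f G.supp_subset_region closure_subset by (metis subsetD subset_trans)
  have "G.below (f (Suc k)) (f k)" for k
    using f(1,3) closure_subset[of "G.supp (f k)"] by (auto simp: G.below_iff)
  then have "H.point_seq (\<lambda>k. \<phi> (f k))"
    using G.point_seq_if_converges[OF f(1) _ x conv] f(1) by (simp add: point_seq_iso)
  then obtain y where "y \<in> Y" "H.converges (\<lambda>k. \<phi> (f k)) y"
    using H.converges_if_point_seq by blast
  then show ?thesis
    using correspondsI[OF f(1) x _ conv] by blast
qed

lemma ex_corresponds':
  assumes y: "y \<in> Y"
  shows "\<exists>x. corresponds x y"
proof -
  obtain h where h: "\<And>k. h k \<in> carrier H" "\<And>k::nat. y \<in> H.supp (h k)"
    "\<And>k. H.supp (h (Suc k)) \<subseteq> H.supp (h k)"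
    "\<And>U. open U \<Longrightarrow> y \<in> U \<Longrightarrow> \<exists>k. closure (H.supp (h k)) \<subseteq> U"
    using H.point_base[OF y] by metis
  have conv: "H.converges h y"
    unfolding H.converges_def using h H.supp_subset_region closure_subset by (metis subsetD subset_trans)
  have "H.below (h (Suc k)) (h k)" for k
    using h(1,3) closure_subset[of "H.supp (h k)"] by (auto simp: H.below_iff)
  then have ps: "H.point_seq h"
    using H.point_seq_if_converges[OF h(1) _ y conv] by blast
  have "\<forall>k. \<exists>f. f \<in> carrier G \<and> \<phi> f = h k"
    using h(1) phi_surj by (metis imageE)
  then obtain f where f: "\<And>k. f k \<in> carrier G" "\<And>k. \<phi> (f k) = h k"
    by metis
  then have "G.point_seq f"
    using ps point_seq_iso[of f] by simp
  then obtain x where "x \<in> X" "G.converges f x"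
    using G.converges_if_point_seq by blast
  then show ?thesis
    using correspondsI[of f x y] f conv y by auto
qed

lemma corresponds_inj:
  assumes "corresponds x y" "corresponds x' y"
  shows "x = x'"
  using assms by (intro G.regions_separate) (auto simp: corresponds_def)

lemma corresponds_unique:
  assumes "corresponds x y" "corresponds x y'"
  shows "y = y'"
proof (rule H.regions_separate)
  show "y \<in> H.region h \<longleftrightarrow> y' \<in> H.region h" if "h \<in> carrier H" for h
    using that assms by (auto simp: corresponds_def phi_surj)
qed (use assms in \<open>auto simp: corresponds_def\<close>)

lemma corresponds_act:
  assumes xy: "corresponds x y" and g: "g \<in> carrier G"
  shows "corresponds (g x) (\<phi> g y)"
  unfolding corresponds_def
proof (intro conjI ballI)
  have "x \<in> X" "y \<in> Y"
    using xy by (auto simp: corresponds_def)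
  then show "g x \<in> X" "\<phi> g y \<in> Y"
    using g by auto
  fix f assume f: "f \<in> carrier G"
  define f' where "f' = G.conj_by (inv g) f"
  have f': "f' \<in> carrier G" "G.conj_by g f' = f"
    using f g G.conj_by_inv[of "inv g" f] by (auto simp: f'_def)
  have "g x \<in> G.region f \<longleftrightarrow> x \<in> G.region f'"
    using G.region_conj_by[OF g f'(1) \<open>x \<in> X\<close>] f' by simp
  also have "\<dots> \<longleftrightarrow> y \<in> H.region (\<phi> f')"
    using xy f' by (simp add: corresponds_def)
  also have "\<dots> \<longleftrightarrow> \<phi> g y \<in> H.region (H.conj_by (\<phi> g) (\<phi> f'))"
    using H.region_conj_by[OF phi_closed[OF g] phi_closed[OF f'(1)] \<open>y \<in> Y\<close>] by simp
  also have "H.conj_by (\<phi> g) (\<phi> f') = \<phi> f"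
    using phi_conj_by[OF f'(1) g] f' by simp
  finally show "g x \<in> G.region f \<longleftrightarrow> \<phi> g y \<in> H.region (\<phi> f)" .
qed

text \<open>Regions, cut down to the space, form a base of the topology on either side, and
  \<open>\<tau>\<close> matches the region of \<open>g\<close> with that of \<open>\<phi> g\<close>;
  openness and continuity are read off from this.\<close>

theorem reconstruction:
  "\<exists>\<tau>. homeomorphic_map (top_of_set X) (top_of_set Y) \<tau> \<and>
    (\<forall>g\<in>carrier G. \<forall>y\<in>Y. \<phi> g y = \<tau> (g (inv_into X \<tau> y)))"
proof -
  obtain \<tau> where \<tau>: "\<And>x. x \<in> X \<Longrightarrow> corresponds x (\<tau> x)"
    using ex_corresponds by metis
  have \<tau>_eq: "\<tau> x = y" if "corresponds x y" for x y
  proof -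
    have "x \<in> X"
      using that by (simp add: corresponds_def)
    then show ?thesis
      using corresponds_unique[OF \<tau> that] by blast
  qed
  have inj: "inj_on \<tau> X"
    using \<tau> corresponds_inj by (metis inj_onI)
  have surj: "\<tau> ` X = Y"
  proof
    show "\<tau> ` X \<subseteq> Y"
      using \<tau> by (auto simp: corresponds_def)
    show "Y \<subseteq> \<tau> ` X"
      using ex_corresponds' \<tau>_eq by (metis corresponds_def image_eqI subsetI)
  qed
  have region: "x \<in> G.region g \<longleftrightarrow> \<tau> x \<in> H.region (\<phi> g)" if "x \<in> X" "g \<in> carrier G" for x g
    using \<tau> that by (auto simp: corresponds_def)
  have "open_map (top_of_set X) (top_of_set Y) \<tau>"
    unfolding open_map_def
  proof (intro allI impI)
    fix U assume "openin (top_of_set X) U"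
    then have U: "open U" "U \<subseteq> X"
      using G.open_X by (auto simp: openin_open_eq)
    have "\<exists>T. open T \<and> z \<in> T \<and> T \<subseteq> \<tau> ` U" if z: "z \<in> \<tau> ` U" for z
    proof -
      obtain x where x: "x \<in> U" "x \<in> X" "z = \<tau> x"
        using z U by auto
      obtain g where g: "g \<in> carrier G" "x \<in> G.region g" "G.region g \<subseteq> U"
        using G.small_region[OF x(2) U(1) x(1)] by blast
      have "H.region (\<phi> g) \<inter> Y \<subseteq> \<tau> ` U"
        using g region surj by blast
      moreover have "open (H.region (\<phi> g) \<inter> Y)" "z \<in> H.region (\<phi> g) \<inter> Y"
        using H.open_region H.open_X x g region surj by auto
      ultimately show ?thesis
        by blast
    qed
    then have "open (\<tau> ` U)"
      by (subst open_subopen) blast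
    then show "openin (top_of_set Y) (\<tau> ` U)"
      using U surj H.open_X by (auto simp: openin_open_eq)
  qed
  moreover have "continuous_map (top_of_set X) (top_of_set Y) \<tau>"
    unfolding continuous_map_def
  proof (intro conjI allI impI)
    fix V assume "openin (top_of_set Y) V"
    then have V: "open V" "V \<subseteq> Y"
      using H.open_X by (auto simp: openin_open_eq)
    have "\<exists>T. open T \<and> x \<in> T \<and> T \<subseteq> {x\<in>X. \<tau> x \<in> V}" if x: "x \<in> {x\<in>X. \<tau> x \<in> V}" for x
    proof -
      obtain h where h: "h \<in> carrier H" "\<tau> x \<in> H.region h" "H.region h \<subseteq> V"
        using H.small_region[of "\<tau> x" V] x V by auto
      then obtain g where g: "g \<in> carrier G" "h = \<phi> g"
        using phi_surj by auto
      have "G.region g \<inter> X \<subseteq> {x\<in>X. \<tau> x \<in> V}"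
        using g h region by blast
      moreover have "open (G.region g \<inter> X)" "x \<in> G.region g \<inter> X"
        using G.open_region G.open_X x g h region by auto
      ultimately show ?thesis
        by blast
    qed
    then have "open {x\<in>X. \<tau> x \<in> V}"
      by (subst open_subopen) blast
    then show "openin (top_of_set X) {x \<in> topspace (top_of_set X). \<tau> x \<in> V}"
      using G.open_X by (auto simp: openin_open_eq)
  qed (use surj in auto)
  ultimately have "homeomorphic_map (top_of_set X) (top_of_set Y) \<tau>"
    using inj surj by (intro bijective_open_imp_homeomorphic_map) auto
  moreover have "\<phi> g y = \<tau> (g (inv_into X \<tau> y))" if "g \<in> carrier G" "y \<in> Y" for g y
  proof -
    define x where "x = inv_into X \<tau> y"
    have "x \<in> X" "\<tau> x = y"
      using that surj by (auto simp: x_def inv_into_into f_inv_into_f)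
    then show ?thesis
      using \<tau>_eq[OF corresponds_act[OF \<tau>[of x] that(1)]] by (simp add: x_def)
  qed
  ultimately show ?thesis
    by blast
qed

end

section \<open>Gauges in topological vector spaces\<close>

lemma tendsto_scaleR_tvs:
  fixes x :: "'a::topological_real_vector"
  assumes "(f \<longlongrightarrow> c) F" "(g \<longlongrightarrow> x) F"
  shows "((\<lambda>t. f t *\<^sub>R g t) \<longlongrightarrow> c *\<^sub>R x) F"
  using filterlim_compose[OF tendsto_scaleR_Pair, of "\<lambda>t. (f t, g t)" c x F] assms
  by (simp add: nhds_prod[symmetric] tendsto_Pair)

lemma continuous_on_scaleR_tvs:
  fixes g :: "'b::topological_space \<Rightarrow> 'a::topological_real_vector"
  assumes "continuous_on S f" "continuous_on S g"
  shows "continuous_on S (\<lambda>t. f t *\<^sub>R g t)"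
  using assms unfolding continuous_on_def by (auto intro: tendsto_scaleR_tvs)

definition disk :: "'a::topological_real_vector set \<Rightarrow> bool" where
  "disk D \<longleftrightarrow> open D \<and> convex D \<and> 0 \<in> D \<and> (\<forall>x\<in>D. - x \<in> D)"

lemma disk_scaleR:
  assumes D: "disk D" and x: "x \<in> D" and t: "\<bar>t\<bar> \<le> 1"
  shows "t *\<^sub>R x \<in> D"
proof -
  have pos: "s *\<^sub>R y \<in> D" if "0 \<le> s" "s \<le> 1" "y \<in> D" for s y
    using D that convexD[of D y 0 s "1 - s"] by (simp add: disk_def)
  show ?thesis
  proof (cases "0 \<le> t")
    case False
    then have "(- t) *\<^sub>R (- x) \<in> D"
      using pos[of "- t" "- x"] D t x by (simp add: disk_def)
    then show ?thesis
      by simp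
  qed (use pos[of t x] x t in auto)
qed

lemma absorb:
  fixes x :: "'a::topological_real_vector"
  assumes "open U" "0 \<in> U"
  obtains e where "0 < e" "\<And>t. \<bar>t\<bar> < e \<Longrightarrow> t *\<^sub>R x \<in> U"
proof -
  have "continuous_on UNIV (\<lambda>t::real. t *\<^sub>R x)"
    by (intro continuous_on_scaleR_tvs continuous_intros)
  then have "open ((\<lambda>t::real. t *\<^sub>R x) -` U)"
    using assms by (intro open_vimage)
  then obtain e where "0 < e" "ball 0 e \<subseteq> (\<lambda>t::real. t *\<^sub>R x) -` U"
    using assms openE[of "(\<lambda>t::real. t *\<^sub>R x) -` U" 0] by auto
  then show thesis
    by (intro that[of e]) (auto simp: subset_iff)
qed

definition minkowski :: "'a::topological_real_vector set \<Rightarrow> 'a \<Rightarrow> real" where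
  "minkowski D x = Inf {r. 0 < r \<and> inverse r *\<^sub>R x \<in> D}"

text \<open>\<open>D\<close> is the open unit ball of its gauge: openness leaves room to enlarge the
  factor \<open>inverse r\<close> slightly, which makes the inequality strict; the converse scales
  down inside \<open>D\<close>.\<close>

lemma minkowski_less_iff:
  assumes D: "disk D" and "0 < r"
  shows "minkowski D x < r \<longleftrightarrow> inverse r *\<^sub>R x \<in> D"
proof -
  let ?S = "{r. 0 < r \<and> inverse r *\<^sub>R x \<in> D}"
  obtain e where e: "0 < e" "\<And>t. \<bar>t\<bar> < e \<Longrightarrow> t *\<^sub>R x \<in> D"
    using absorb[of D x] D by (auto simp: disk_def)
  then have "2 / e \<in> ?S"
    using e(2)[of "e / 2"] by simp
  then have ne: "?S \<noteq> {}"
    by blast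
  have bdd: "bdd_below ?S"
    by (rule bdd_belowI[of _ 0]) auto
  have less: "minkowski D x < s \<longleftrightarrow> (\<exists>r\<in>?S. r < s)" for s
    unfolding minkowski_def by (rule cInf_less_iff[OF ne bdd])
  show ?thesis
  proof
    assume "minkowski D x < r"
    then obtain s where s: "0 < s" "inverse s *\<^sub>R x \<in> D" "s < r"
      using less by auto
    then have "(s / r) *\<^sub>R (inverse s *\<^sub>R x) \<in> D"
      using disk_scaleR[OF D, of "inverse s *\<^sub>R x" "s / r"] by simp
    then show "inverse r *\<^sub>R x \<in> D"
      using s by (simp add: field_simps)
  next
    assume r: "inverse r *\<^sub>R x \<in> D"
    have "continuous_on UNIV (\<lambda>t::real. inverse r *\<^sub>R x + t *\<^sub>R x)"
      by (intro continuous_on_scaleR_tvs continuous_intros)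
    then have "open ((\<lambda>t::real. inverse r *\<^sub>R x + t *\<^sub>R x) -` D)"
      using D by (intro open_vimage) (auto simp: disk_def)
    then obtain d where d: "0 < d" "ball 0 d \<subseteq> (\<lambda>t::real. inverse r *\<^sub>R x + t *\<^sub>R x) -` D"
      using r openE[of "(\<lambda>t::real. inverse r *\<^sub>R x + t *\<^sub>R x) -` D" 0] by auto
    then have "d / 2 \<in> (\<lambda>t::real. inverse r *\<^sub>R x + t *\<^sub>R x) -` D"
      by (intro subsetD[OF d(2)]) auto
    then have "(inverse r + d / 2) *\<^sub>R x \<in> D"
      by (simp add: scaleR_add_left)
    then have "inverse (inverse r + d / 2) \<in> ?S"
      using d \<open>0 < r\<close> by (auto intro!: add_pos_pos)
    moreover have "inverse (inverse r + d / 2) < inverse (inverse r)"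
      using d \<open>0 < r\<close> by (intro less_imp_inverse_less) auto
    then have "inverse (inverse r + d / 2) < r"
      by simp
    ultimately show "minkowski D x < r"
      unfolding less by blast
  qed
qed

lemma minkowski_nonneg:
  assumes "disk D"
  shows "0 \<le> minkowski D x"
proof -
  have "minkowski D x < r \<Longrightarrow> 0 < r" for r
  proof (rule ccontr)
    assume r: "minkowski D x < r" "\<not> 0 < r"
    obtain e where e: "0 < e" "\<And>t. \<bar>t\<bar> < e \<Longrightarrow> t *\<^sub>R x \<in> D"
      using absorb[of D x] assms by (auto simp: disk_def)
    then have "{r. 0 < r \<and> inverse r *\<^sub>R x \<in> D} \<noteq> {}"
      using e(2)[of "e / 2"] by (auto intro!: exI[of _ "2 / e"])
    then have "0 \<le> minkowski D x"
      unfolding minkowski_def by (rule cInf_greatest) auto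
    then show False
      using r by simp
  qed
  then show ?thesis
    using dense[of "minkowski D x" 0] by force
qed

lemma minkowski_scaleR:
  assumes D: "disk D"
  shows "minkowski D (t *\<^sub>R x) = \<bar>t\<bar> * minkowski D x"
proof (cases "t = 0")
  case True
  have "minkowski D 0 < r" if "0 < r" for r
    using minkowski_less_iff[OF D that, of 0] D by (simp add: disk_def)
  then have "minkowski D 0 \<le> 0"
    using dense by (metis less_irrefl linorder_not_le)
  then show ?thesis
    using True minkowski_nonneg[OF D, of 0] by simp
next
  case False
  have *: "minkowski D (t *\<^sub>R x) < r \<longleftrightarrow> \<bar>t\<bar> * minkowski D x < r" for r
  proof (cases "0 < r")
    case r: True
    have "y \<in> D \<longleftrightarrow> - y \<in> D" for y
      using D unfolding disk_def by (metis minus_minus)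
    from this[of "(inverse r * t) *\<^sub>R x"]
    have "(inverse r * t) *\<^sub>R x \<in> D \<longleftrightarrow> (inverse r * \<bar>t\<bar>) *\<^sub>R x \<in> D"
      by (simp add: abs_if)
    moreover have "inverse (r / \<bar>t\<bar>) = inverse r * \<bar>t\<bar>"
      by (simp add: field_simps)
    ultimately have "minkowski D (t *\<^sub>R x) < r \<longleftrightarrow> minkowski D x < r / \<bar>t\<bar>"
      using r False by (simp add: minkowski_less_iff[OF D])
    then show ?thesis
      using False by (simp add: field_simps)
  next
    case r: False
    moreover have "0 \<le> \<bar>t\<bar> * minkowski D x"
      using minkowski_nonneg[OF D, of x] by simp
    ultimately show ?thesis
      using minkowski_nonneg[OF D, of "t *\<^sub>R x"] by linarith
  qed
  show ?thesis
    using *[of "minkowski D (t *\<^sub>R x)"] *[of "\<bar>t\<bar> * minkowski D x"] by linarith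
qed

lemma minkowski_add:
  assumes D: "disk D"
  shows "minkowski D (x + y) \<le> minkowski D x + minkowski D y"
proof (rule field_le_epsilon)
  fix e :: real assume "0 < e"
  define r s where "r = minkowski D x + e / 2" "s = minkowski D y + e / 2"
  have rs: "0 < r" "0 < s"
    using minkowski_nonneg[OF D, of x] minkowski_nonneg[OF D, of y] \<open>0 < e\<close> by (auto simp: r_s_def)
  have "inverse r *\<^sub>R x \<in> D" "inverse s *\<^sub>R y \<in> D"
    using minkowski_less_iff[OF D rs(1), of x] minkowski_less_iff[OF D rs(2), of y] \<open>0 < e\<close>
    by (auto simp: r_s_def)
  then have "(r / (r + s)) *\<^sub>R (inverse r *\<^sub>R x) + (s / (r + s)) *\<^sub>R (inverse s *\<^sub>R y) \<in> D"
    using D rs by (intro convexD) (auto simp: disk_def simp flip: add_divide_distrib)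
  also have "(r / (r + s)) *\<^sub>R (inverse r *\<^sub>R x) = inverse (r + s) *\<^sub>R x"
    using rs by (simp add: field_simps)
  also have "(s / (r + s)) *\<^sub>R (inverse s *\<^sub>R y) = inverse (r + s) *\<^sub>R y"
    using rs by (simp add: field_simps)
  finally have "inverse (r + s) *\<^sub>R (x + y) \<in> D"
    by (simp add: scaleR_add_right)
  then show "minkowski D (x + y) \<le> minkowski D x + minkowski D y + e"
    using minkowski_less_iff[OF D, of "r + s" "x + y"] rs by (simp add: r_s_def)
qed

lemma minkowski_diff:
  assumes D: "disk D"
  shows "\<bar>minkowski D x - minkowski D y\<bar> \<le> minkowski D (x - y)"
  using minkowski_add[OF D, of "x - y" y] minkowski_add[OF D, of "y - x" x]
    minkowski_scaleR[OF D, of "-1" "x - y"] by simp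

text \<open>A tent over the translate of \<open>D\<close> to \<open>a\<close>. Its differences are
  bounded by the gauge of the displacement, so it is uniformly continuous and its slope in a
  direction \<open>v\<close> is at most the gauge of \<open>v\<close>.\<close>

definition bump :: "'a::topological_real_vector set \<Rightarrow> 'a \<Rightarrow> 'a \<Rightarrow> real" where
  "bump D a x = max 0 (1 - minkowski D (x - a))"

lemma bump_range: "disk D \<Longrightarrow> 0 \<le> bump D a x \<and> bump D a x \<le> 1"
  using minkowski_nonneg[of D "x - a"] by (simp add: bump_def)

lemma bump_center: "disk D \<Longrightarrow> bump D a a = 1"
  using minkowski_scaleR[of D 0 0] by (simp add: bump_def)

lemma bump_nonzero_iff: "disk D \<Longrightarrow> bump D a x \<noteq> 0 \<longleftrightarrow> x - a \<in> D"
  using minkowski_less_iff[of D 1 "x - a"] by (auto simp: bump_def)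

lemma bump_diff: "disk D \<Longrightarrow> \<bar>bump D a x - bump D a y\<bar> \<le> minkowski D (x - y)"
  using minkowski_diff[of D "x - a" "y - a"] by (auto simp: bump_def)

section \<open>Shears\<close>

text \<open>A countable substitute for an invariant metric: the step from \<open>n\<close> to
  \<open>Suc n\<close> plays the part of halving a radius, and \<open>C_separating\<close> is the
  Hausdorff property.\<close>

locale disk_base =
  fixes C :: "nat \<Rightarrow> 'a::topological_real_vector set"
  assumes disk_C: "disk (C n)"
    and C_add: "x \<in> C (Suc n) \<Longrightarrow> y \<in> C (Suc n) \<Longrightarrow> x + y \<in> C n"
    and C_base: "open U \<Longrightarrow> 0 \<in> U \<Longrightarrow> \<exists>n. C n \<subseteq> U"
    and C_separating: "x \<noteq> 0 \<Longrightarrow> \<exists>n. x \<notin> C n"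
begin

lemma open_C: "open (C n)" and zero_C [simp]: "0 \<in> C n" and minus_C: "x \<in> C n \<Longrightarrow> - x \<in> C n"
  and convex_C: "convex (C n)"
  using disk_C by (auto simp: disk_def)

lemma minus_C_iff [simp]: "- x \<in> C n \<longleftrightarrow> x \<in> C n"
  using minus_C[of x n] minus_C[of "- x" n] by auto

lemma diff_C_commute: "x - y \<in> C n \<longleftrightarrow> y - x \<in> C n"
  using minus_C_iff[of "x - y" n] by simp

lemma C_diff: "x \<in> C (Suc n) \<Longrightarrow> y \<in> C (Suc n) \<Longrightarrow> x - y \<in> C n"
  using C_add[of x n "- y"] by simp

lemma C_antimono: "m \<le> n \<Longrightarrow> C n \<subseteq> C m"
proof (induction rule: dec_induct)
  case (step n)
  have "C (Suc n) \<subseteq> C n"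
    using C_add[OF _ zero_C] by fastforce
  then show ?case
    using step by blast
qed simp

lemma open_C_translate: "open {y. y - x \<in> C n}"
proof -
  have "open ((\<lambda>y. y - x) -` C n)"
    by (intro open_vimage open_C continuous_intros)
  then show ?thesis
    by (simp add: vimage_def)
qed

lemma nbhd_C:
  assumes "open U" "x \<in> U"
  obtains n where "\<And>y. y - x \<in> C n \<Longrightarrow> y \<in> U"
proof -
  have "open ((\<lambda>d. x + d) -` U)"
    by (intro open_vimage assms continuous_intros)
  then obtain n where "C n \<subseteq> (\<lambda>d. x + d) -` U"
    using C_base[of "(\<lambda>d. x + d) -` U"] assms by auto
  then show thesis
    by (intro that[of n]) force
qed

lemma open_if_C:
  assumes "\<And>x. x \<in> U \<Longrightarrow> \<exists>n. \<forall>y. y - x \<in> C n \<longrightarrow> y \<in> U"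
  shows "open U"
proof (subst open_subopen, intro ballI)
  fix x assume "x \<in> U"
  then obtain n where "\<forall>y. y - x \<in> C n \<longrightarrow> y \<in> U"
    using assms by blast
  then show "\<exists>T. open T \<and> x \<in> T \<and> T \<subseteq> U"
    using open_C_translate[of x n] by (intro exI[of _ "{y. y - x \<in> C n}"]) auto
qed

lemma closure_C:
  assumes "z \<in> closure A"
  obtains a where "a \<in> A" "z - a \<in> C n"
proof -
  have "z \<in> {y. y - z \<in> C n} \<inter> closure A"
    using assms by simp
  then have "{y. y - z \<in> C n} \<inter> A \<noteq> {}"
    using open_Int_closure_eq_empty[OF open_C_translate] by blast
  then obtain a where "a \<in> A" "a - z \<in> C n"
    by blast
  then show thesis
    by (intro that[of a]) (auto simp: diff_C_commute)
qed

lemma small_multiple: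
  obtains e where "0 < e" "\<And>t. \<bar>t\<bar> < e \<Longrightarrow> t *\<^sub>R x \<in> C n"
  using absorb[OF open_C[of n] zero_C] by blast

lemma minkowski_small:
  assumes D: "disk D" and "0 < e"
  shows "\<exists>n. \<forall>d\<in>C n. minkowski D d < e"
proof -
  have "continuous_on UNIV (\<lambda>x::'a. inverse e *\<^sub>R x)"
    by (intro continuous_on_scaleR_tvs continuous_intros)
  then have "open ((\<lambda>x. inverse e *\<^sub>R x) -` D)"
    using D by (intro open_vimage) (auto simp: disk_def)
  then obtain n where "C n \<subseteq> (\<lambda>x. inverse e *\<^sub>R x) -` D"
    using C_base[of "(\<lambda>x. inverse e *\<^sub>R x) -` D"] D by (auto simp: disk_def)
  then show ?thesis
    using minkowski_less_iff[OF D \<open>0 < e\<close>] by auto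
qed

lemma eventually_uniformity_C:
  "eventually P (uniformity :: ('a \<times> 'a) filter) \<longleftrightarrow> (\<exists>n. \<forall>x y. y - x \<in> C n \<longrightarrow> P (x, y))"
proof
  assume "eventually P uniformity"
  then obtain S where S: "open S" "0 \<in> S" "\<And>x y. y - x \<in> S \<Longrightarrow> P (x, y)"
    unfolding uniformity_eq eventually_filtercomap eventually_nhds by force
  then show "\<exists>n. \<forall>x y. y - x \<in> C n \<longrightarrow> P (x, y)"
    using C_base[of S] by blast
next
  assume "\<exists>n. \<forall>x y. y - x \<in> C n \<longrightarrow> P (x, y)"
  then obtain n where "\<And>x y. y - x \<in> C n \<Longrightarrow> P (x, y)"
    by blast
  then show "eventually P uniformity"
    unfolding uniformity_eq eventually_filtercomap eventually_nhds
    using open_C[of n] by (intro exI[of _ "\<lambda>d. d \<in> C n"]) auto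
qed

lemma uniformly_continuous_onI_C:
  fixes f :: "'a \<Rightarrow> 'a"
  assumes "\<And>n. \<exists>m. \<forall>x\<in>U. \<forall>y\<in>U. y - x \<in> C m \<longrightarrow> f y - f x \<in> C n"
  shows "uniformly_continuous_on U f"
  unfolding uniformly_continuous_on_uniformity filterlim_iff
proof (intro allI impI)
  fix P assume "eventually P (uniformity :: ('a \<times> 'a) filter)"
  then obtain n where n: "\<And>x y. y - x \<in> C n \<Longrightarrow> P (x, y)"
    by (auto simp: eventually_uniformity_C)
  obtain m where "\<forall>x\<in>U. \<forall>y\<in>U. y - x \<in> C m \<longrightarrow> f y - f x \<in> C n"
    using assms by blast
  then show "eventually (\<lambda>p. P (case p of (x, y) \<Rightarrow> (f x, f y))) (uniformity_on U)"
    unfolding eventually_inf_principal eventually_uniformity_C using n by (intro exI[of _ m]) auto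
qed

lemma continuous_onI_C:
  fixes f :: "'a \<Rightarrow> 'a"
  assumes "open U" "\<And>x n. x \<in> U \<Longrightarrow> \<exists>m. \<forall>y\<in>U. y - x \<in> C m \<longrightarrow> f y - f x \<in> C n"
  shows "continuous_on U f"
  unfolding continuous_on_open_vimage[OF assms(1)]
proof (intro allI impI)
  fix B :: "'a set" assume "open B"
  show "open (f -` B \<inter> U)"
  proof (rule open_if_C)
    fix x assume x: "x \<in> f -` B \<inter> U"
    obtain n where n: "\<And>y. y - f x \<in> C n \<Longrightarrow> y \<in> B"
      using nbhd_C[OF \<open>open B\<close>] x by blast
    obtain m where m: "\<forall>y\<in>U. y - x \<in> C m \<longrightarrow> f y - f x \<in> C n"
      using assms x by blast
    obtain k where k: "\<And>y. y - x \<in> C k \<Longrightarrow> y \<in> U"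
      using nbhd_C[OF \<open>open U\<close>] x by blast
    show "\<exists>n. \<forall>y. y - x \<in> C n \<longrightarrow> y \<in> f -` B \<inter> U"
      using n m k C_antimono[OF max.cobounded1[of m k]] C_antimono[OF max.cobounded2[of k m]]
      by (intro exI[of _ "max m k"]) (metis IntI subsetD vimageI2)
  qed
qed

end

text \<open>
  Along the lines of direction \<open>v\<close> the map \<open>x \<mapsto> x + \<phi> x v\<close> is a strictly increasing
  perturbation of the identity, since \<open>\<phi>\<close> is Lipschitz with constant \<open>c < 1\<close> there.
\<close>

locale shear = disk_base C for C :: "nat \<Rightarrow> 'a::topological_real_vector set" +
  fixes \<phi> :: "'a \<Rightarrow> real" and v :: 'a and c :: real and X :: "'a set"
  assumes range: "0 \<le> \<phi> x" "\<phi> x \<le> 1"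
    and c: "c < 1"
    and lipschitz: "\<bar>\<phi> (x + t *\<^sub>R v) - \<phi> x\<bar> \<le> c * \<bar>t\<bar>"
    and locally_uniform: "\<exists>n. \<forall>e>0. \<exists>m. \<forall>y z. y - x \<in> C n \<longrightarrow> z - x \<in> C n \<longrightarrow> z - y \<in> C m \<longrightarrow>
      \<bar>\<phi> z - \<phi> y\<bar> < e"
    and open_X: "open X"
    and support: "\<phi> x \<noteq> 0 \<Longrightarrow> x \<in> X"
begin

definition h :: "'a \<Rightarrow> 'a" where
  "h x = x + \<phi> x *\<^sub>R v"

text \<open>The point \<open>x + (h y - h x)\<close> differs from \<open>y\<close> by a multiple of
  \<open>v\<close>, so the Lipschitz bound compares the values of \<open>\<phi>\<close> there.
  Injectivity of \<open>h\<close> and the modulus of its inverse both come from this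
  estimate.\<close>

lemma h_estimate: "(1 - c) * \<bar>\<phi> y - \<phi> x\<bar> \<le> \<bar>\<phi> (x + (h y - h x)) - \<phi> x\<bar>"
proof -
  have "x + (h y - h x) = y + (\<phi> y - \<phi> x) *\<^sub>R v"
    by (simp add: h_def algebra_simps)
  then have "\<bar>\<phi> (x + (h y - h x)) - \<phi> y\<bar> \<le> c * \<bar>\<phi> y - \<phi> x\<bar>"
    using lipschitz[of y "\<phi> y - \<phi> x"] by simp
  then show ?thesis
    by (simp add: left_diff_distrib)
qed

lemma h_inj: "inj h"
proof (rule injI)
  fix x y assume eq: "h x = h y"
  then have "(1 - c) * \<bar>\<phi> y - \<phi> x\<bar> \<le> 0"
    using h_estimate[of y x] by simp
  then have "\<phi> y = \<phi> x"
    using c by (simp add: mult_le_0_iff)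
  then show "x = y"
    using eq by (simp add: h_def)
qed

text \<open>A preimage \<open>y - t v\<close> corresponds to a zero of
  \<open>t - \<phi> (y - t v)\<close>, and this function changes sign on the unit interval because
  \<open>\<phi>\<close> takes values there.\<close>

lemma h_surj: "surj h"
  unfolding surj_def
proof
  fix y
  define f where "f t = t - \<phi> (y - t *\<^sub>R v)" for t :: real
  have lip: "\<bar>\<phi> (y - s *\<^sub>R v) - \<phi> (y - t *\<^sub>R v)\<bar> \<le> c * \<bar>s - t\<bar>" for s t
    using lipschitz[of "y - t *\<^sub>R v" "t - s"] by (simp add: algebra_simps abs_minus_commute)
  have "continuous_on {0..1} (\<lambda>t. \<phi> (y - t *\<^sub>R v))"
  proof (rule lipschitz_on_continuous_on)
    show "\<bar>c\<bar>-lipschitz_on {0..1} (\<lambda>t. \<phi> (y - t *\<^sub>R v))"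
    proof (rule lipschitz_onI)
      fix s t :: real
      have "c * \<bar>s - t\<bar> \<le> \<bar>c\<bar> * \<bar>s - t\<bar>"
        by (intro mult_right_mono) auto
      then show "dist (\<phi> (y - s *\<^sub>R v)) (\<phi> (y - t *\<^sub>R v)) \<le> \<bar>c\<bar> * dist s t"
        using lip[of s t] by (simp add: dist_real_def)
    qed simp
  qed
  then have "continuous_on {0..1} f"
    unfolding f_def by (intro continuous_intros)
  moreover have "f 0 \<le> 0" "0 \<le> f 1"
    using range by (auto simp: f_def)
  ultimately obtain t where "f t = 0"
    using IVT'[of f 0 0 1] by auto
  then show "\<exists>x. y = h x"
    by (intro exI[of _ "y - t *\<^sub>R v"]) (simp add: f_def h_def)
qed

lemma h_fixed: "x \<notin> X \<Longrightarrow> h x = x"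
  using support by (auto simp: h_def)

lemma h_in_iff: "h x \<in> X \<longleftrightarrow> x \<in> X"
proof
  show "h x \<in> X \<Longrightarrow> x \<in> X"
    using h_fixed by force
  show "x \<in> X \<Longrightarrow> h x \<in> X"
    using h_fixed h_inj by (metis injD)
qed

lemma h_uniform:
  assumes n: "\<forall>e>0. \<exists>m. \<forall>y z. y - x \<in> C n \<longrightarrow> z - x \<in> C n \<longrightarrow> z - y \<in> C m \<longrightarrow>
      \<bar>\<phi> z - \<phi> y\<bar> < e"
  shows "\<exists>m. \<forall>y z. y - x \<in> C n \<longrightarrow> z - x \<in> C n \<longrightarrow> z - y \<in> C m \<longrightarrow> h z - h y \<in> C k"
proof -
  obtain e where e: "0 < e" "\<And>t. \<bar>t\<bar> < e \<Longrightarrow> t *\<^sub>R v \<in> C (Suc k)"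
    using small_multiple by blast
  obtain m where m: "\<forall>y z. y - x \<in> C n \<longrightarrow> z - x \<in> C n \<longrightarrow> z - y \<in> C m \<longrightarrow> \<bar>\<phi> z - \<phi> y\<bar> < e"
    using n e by blast
  show ?thesis
  proof (intro exI allI impI)
    fix y z assume yz: "y - x \<in> C n" "z - x \<in> C n" "z - y \<in> C (max m (Suc k))"
    then have "z - y \<in> C m" "z - y \<in> C (Suc k)"
      using C_antimono[of m "max m (Suc k)"] C_antimono[of "Suc k" "max m (Suc k)"] by auto
    then have "(z - y) + (\<phi> z - \<phi> y) *\<^sub>R v \<in> C k"
      using m e yz by (intro C_add) auto
    then show "h z - h y \<in> C k"
      by (simp add: h_def algebra_simps)
  qed
qed

text \<open>Only \<open>y\<close> is confined near \<open>x\<close>: the modulus of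
  \<open>\<phi>\<close> is applied at \<open>y + (h z - h y)\<close>, which is close to
  \<open>x\<close>, so \<open>z\<close> may range over the whole space.\<close>

lemma h_inverse_uniform:
  assumes n: "\<forall>e>0. \<exists>m. \<forall>y z. y - x \<in> C n \<longrightarrow> z - x \<in> C n \<longrightarrow> z - y \<in> C m \<longrightarrow>
      \<bar>\<phi> z - \<phi> y\<bar> < e"
  shows "\<exists>m. \<forall>y z. y - x \<in> C (Suc n) \<longrightarrow> h z - h y \<in> C m \<longrightarrow> z - y \<in> C k"
proof -
  obtain e where e: "0 < e" "\<And>t. \<bar>t\<bar> < e \<Longrightarrow> t *\<^sub>R v \<in> C (Suc k)"
    using small_multiple by blast
  have "0 < (1 - c) * e"
    using c e by simp
  then obtain m where m: "\<forall>y z. y - x \<in> C n \<longrightarrow> z - x \<in> C n \<longrightarrow> z - y \<in> C m \<longrightarrow>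
      \<bar>\<phi> z - \<phi> y\<bar> < (1 - c) * e"
    using n by blast
  let ?m = "m + Suc n + Suc k"
  show ?thesis
  proof (intro exI allI impI)
    fix y z assume yz: "y - x \<in> C (Suc n)" "h z - h y \<in> C ?m"
    define d where "d = h z - h y"
    have d: "d \<in> C m" "d \<in> C (Suc n)" "d \<in> C (Suc k)"
      using yz C_antimono[of m ?m] C_antimono[of "Suc n" ?m] C_antimono[of "Suc k" ?m]
      by (auto simp: d_def)
    have "y + d - x \<in> C n" "y - x \<in> C n"
      using C_add[OF yz(1) d(2)] C_add[OF yz(1) zero_C] by (simp_all add: algebra_simps)
    then have "\<bar>\<phi> (y + d) - \<phi> y\<bar> < (1 - c) * e"
      using m d by simp
    then have "(1 - c) * \<bar>\<phi> z - \<phi> y\<bar> < (1 - c) * e"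
      using h_estimate[of z y] by (simp add: d_def)
    then have "\<bar>\<phi> z - \<phi> y\<bar> < e"
      using c by simp
    then have "d - (\<phi> z - \<phi> y) *\<^sub>R v \<in> C k"
      using d e by (intro C_diff) auto
    then show "z - y \<in> C k"
      by (simp add: d_def h_def algebra_simps)
  qed
qed

lemma h_continuous: "continuous_on X h"
proof (rule continuous_onI_C[OF open_X])
  fix x k
  obtain n where n: "\<forall>e>0. \<exists>m. \<forall>y z. y - x \<in> C n \<longrightarrow> z - x \<in> C n \<longrightarrow> z - y \<in> C m \<longrightarrow>
      \<bar>\<phi> z - \<phi> y\<bar> < e"
    using locally_uniform by blast
  obtain m where m: "\<forall>y z. y - x \<in> C n \<longrightarrow> z - x \<in> C n \<longrightarrow> z - y \<in> C m \<longrightarrow> h z - h y \<in> C k"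
    using h_uniform[OF n] by blast
  show "\<exists>m. \<forall>y\<in>X. y - x \<in> C m \<longrightarrow> h y - h x \<in> C k"
    using m C_antimono[of n "max m n"] C_antimono[of m "max m n"]
    by (intro exI[of _ "max m n"]) (metis diff_self max.cobounded1 max.cobounded2 subsetD zero_C)
qed

definition h_inv :: "'a \<Rightarrow> 'a" where
  "h_inv = inv_into UNIV h"

lemma h_h_inv: "h (h_inv y) = y"
  unfolding h_inv_def using h_surj by (intro f_inv_into_f) auto

lemma h_inv_h: "h_inv (h x) = x"
  unfolding h_inv_def using h_inj by (intro inv_into_f_f) auto

lemma h_inverse_continuous: "continuous_on X h_inv"
proof (rule continuous_onI_C[OF open_X])
  fix x k
  obtain n where n: "\<forall>e>0. \<exists>m. \<forall>y z. y - h_inv x \<in> C n \<longrightarrow> z - h_inv x \<in> C n \<longrightarrow>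
      z - y \<in> C m \<longrightarrow> \<bar>\<phi> z - \<phi> y\<bar> < e"
    using locally_uniform by blast
  obtain m where m: "\<forall>y z. y - h_inv x \<in> C (Suc n) \<longrightarrow> h z - h y \<in> C m \<longrightarrow> z - y \<in> C k"
    using h_inverse_uniform[OF n] by blast
  have "\<forall>y\<in>X. y - x \<in> C m \<longrightarrow> h_inv y - h_inv x \<in> C k"
    using m by (simp add: h_h_inv)
  then show "\<exists>m. \<forall>y\<in>X. y - x \<in> C m \<longrightarrow> h_inv y - h_inv x \<in> C k"
    by blast
qed

lemma restrict_h_homeo:
  "restrict h X \<in> carrier (homeo_group (top_of_set X))"
proof -
  have inX: "h_inv y \<in> X \<longleftrightarrow> y \<in> X" for y
    using h_in_iff[of "h_inv y"] h_h_inv h_inv_h by simp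
  have bij: "bij_betw h X X"
    by (rule bij_betw_byWitness[of _ h_inv]) (use h_h_inv h_inv_h inX h_in_iff in auto)
  have "homeomorphic_maps (top_of_set X) (top_of_set X) h h_inv"
    unfolding homeomorphic_maps_def continuous_map_subtopology_eu
    using h_continuous h_inverse_continuous h_h_inv h_inv_h inX h_in_iff
    by (auto simp: continuous_map_in_subtopology)
  then have "homeomorphic_map (top_of_set X) (top_of_set X) h"
    by (auto simp: homeomorphic_map_maps)
  then have "homeomorphic_map (top_of_set X) (top_of_set X) (restrict h X)"
    by (rule homeomorphic_map_eq) simp
  moreover have "bij_betw (restrict h X) X X"
    using bij by (simp cong: bij_betw_cong)
  ultimately show ?thesis
    by (simp add: homeo_group_def Bij_def)
qed

lemma restrict_h_uniform: "locally_bi_uniformly_continuous X (restrict h X)"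
  unfolding locally_bi_uniformly_continuous_def
proof (intro ballI)
  fix x assume x: "x \<in> X"
  obtain n where n: "\<forall>e>0. \<exists>m. \<forall>y z. y - x \<in> C n \<longrightarrow> z - x \<in> C n \<longrightarrow> z - y \<in> C m \<longrightarrow>
      \<bar>\<phi> z - \<phi> y\<bar> < e"
    using locally_uniform by blast
  \<comment> \<open>The index \<open>Suc n\<close> leaves the margin that the inverse estimate needs
    to stay within the \<open>n\<close>-neighbourhood of \<open>x\<close>.\<close>
  define U where "U = X \<inter> {y. y - x \<in> C (Suc n)}"
  have U: "y \<in> X" "y - x \<in> C (Suc n)" "y - x \<in> C n" if "y \<in> U" for y
    using that C_antimono[of n "Suc n"] by (auto simp: U_def)
  have inj: "inj_on (restrict h X) X"
    using h_inj by (auto simp: inj_on_def dest: injD)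
  have "openin (top_of_set X) U"
    unfolding U_def using open_C_translate by (rule openin_open_Int)
  moreover have "x \<in> U"
    using x by (simp add: U_def)
  moreover have "uniformly_continuous_on U (restrict h X)"
  proof (rule uniformly_continuous_onI_C)
    fix k
    show "\<exists>m. \<forall>y\<in>U. \<forall>z\<in>U. z - y \<in> C m \<longrightarrow> restrict h X z - restrict h X y \<in> C k"
      using h_uniform[OF n, of k] U by (metis restrict_apply')
  qed
  moreover have "uniformly_continuous_on (restrict h X ` U) (inv_into X (restrict h X))"
  proof (rule uniformly_continuous_onI_C)
    fix k
    obtain m where "\<forall>y z. y - x \<in> C (Suc n) \<longrightarrow> h z - h y \<in> C m \<longrightarrow> z - y \<in> C k"
      using h_inverse_uniform[OF n] by blast
    moreover have "inv_into X (restrict h X) (h y) = y" if "y \<in> X" for y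
      using inv_into_f_f[OF inj that] that by simp
    ultimately show "\<exists>m. \<forall>y\<in>restrict h X ` U. \<forall>z\<in>restrict h X ` U. z - y \<in> C m \<longrightarrow>
        inv_into X (restrict h X) z - inv_into X (restrict h X) y \<in> C k"
      using U by (intro exI[of _ m]) auto
  qed
  ultimately show "\<exists>U. openin (top_of_set X) U \<and> x \<in> U \<and> uniformly_continuous_on U (restrict h X) \<and>
      uniformly_continuous_on (restrict h X ` U) (inv_into X (restrict h X))"
    by blast
qed

end

section \<open>Moving a sequence without accumulation points\<close>

context disk_base
begin

lemma closed_singleton: "closed {z :: 'a}"
  unfolding closed_def
proof (rule open_if_C)
  fix x assume "x \<in> - {z}"
  then obtain n where "z - x \<notin> C n"
    using C_separating[of "z - x"] by auto
  then show "\<exists>n. \<forall>y. y - x \<in> C n \<longrightarrow> y \<in> - {z}"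
    by auto
qed

lemma closed_finite: "finite A \<Longrightarrow> closed (A :: 'a set)"
  using closed_UN[of A "\<lambda>x. {x}"] closed_singleton by simp

text \<open>A Lebesgue number argument: \<open>K\<close> is covered by finitely many neighbourhoods
  of half the admissible size.\<close>

lemma compact_closed_gap:
  assumes "compact K" "closed A" "K \<inter> A = {}"
  obtains n where "\<And>x y. x \<in> K \<Longrightarrow> y - x \<in> C n \<Longrightarrow> y \<notin> A"
proof -
  have "\<exists>n. \<forall>y. y - x \<in> C n \<longrightarrow> y \<notin> A" if "x \<in> K" for x
    using nbhd_C[of "- A" x] assms that by (metis ComplD ComplI disjoint_iff open_Compl)
  then obtain n where n: "\<And>x y. x \<in> K \<Longrightarrow> y - x \<in> C (n x) \<Longrightarrow> y \<notin> A"
    by metis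
  obtain F where F: "F \<subseteq> K" "finite F" "K \<subseteq> (\<Union>x\<in>F. {y. y - x \<in> C (Suc (n x))})"
  proof (rule compactE_image[OF assms(1)])
    show "K \<subseteq> (\<Union>x\<in>K. {y. y - x \<in> C (Suc (n x))})"
      by auto
  qed (use open_C_translate in auto)
  \<comment> \<open>For empty \<open>F\<close> this maximum is unspecified, but then
    \<open>K\<close> is empty as well.\<close>
  define m where "m = Max ((\<lambda>x. Suc (n x)) ` F)"
  have "y \<notin> A" if xy: "x \<in> K" "y - x \<in> C m" for x y
  proof -
    obtain z where z: "z \<in> F" "x - z \<in> C (Suc (n z))"
      using F xy by auto
    have "Suc (n z) \<le> m"
      unfolding m_def using F z by (intro Max_ge) auto
    then have "y - x \<in> C (Suc (n z))"
      using C_antimono xy by blast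
    then have "y - z \<in> C (n z)"
      using C_add[OF _ z(2)] by fastforce
    then show ?thesis
      using n z F by blast
  qed
  then show thesis
    using that by blast
qed

text \<open>The disk \<open>C n\<close> stretched to \<open>2\<close> in the directions
  \<open>v\<close> and \<open>- v\<close>. This gives \<open>v\<close> gauge at most 1/2, so a tent
  of height 1 over a tube can push its centre by the full vector \<open>v\<close> and still define
  an invertible shear.\<close>

definition tube :: "'a \<Rightarrow> nat \<Rightarrow> 'a set" where
  "tube v n = {y. \<exists>t. \<bar>t\<bar> < 2 \<and> y - t *\<^sub>R v \<in> C n}"

lemma disk_tube: "disk (tube v n)"
  unfolding disk_def
proof (intro conjI ballI)
  have "tube v n = (\<Union>t\<in>{t. \<bar>t\<bar> < 2}. {y. y - t *\<^sub>R v \<in> C n})"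
    by (auto simp: tube_def)
  then show "open (tube v n)"
    using open_C_translate by auto
  show "convex (tube v n)"
  proof (rule convexI)
    fix x y and r s :: real
    assume xy: "x \<in> tube v n" "y \<in> tube v n" and rs: "0 \<le> r" "0 \<le> s" "r + s = 1"
    obtain t t' where t: "\<bar>t\<bar> < 2" "x - t *\<^sub>R v \<in> C n" "\<bar>t'\<bar> < 2" "y - t' *\<^sub>R v \<in> C n"
      using xy by (auto simp: tube_def)
    have "r *\<^sub>R t + s *\<^sub>R t' \<in> {- 2<..<2}"
      using t rs by (intro convexD) auto
    moreover have "r *\<^sub>R (x - t *\<^sub>R v) + s *\<^sub>R (y - t' *\<^sub>R v) \<in> C n"
      using t rs by (intro convexD[OF convex_C]) auto
    ultimately show "r *\<^sub>R x + s *\<^sub>R y \<in> tube v n"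
      unfolding tube_def by (intro CollectI exI[of _ "r *\<^sub>R t + s *\<^sub>R t'"]) (auto simp: algebra_simps)
  qed
  show "0 \<in> tube v n"
    unfolding tube_def by (intro CollectI exI[of _ 0]) auto
  fix x assume "x \<in> tube v n"
  then obtain t where t: "\<bar>t\<bar> < 2" "x - t *\<^sub>R v \<in> C n"
    by (auto simp: tube_def)
  then have "- x - (- t) *\<^sub>R v \<in> C n"
    using minus_C[OF t(2)] by simp
  then show "- x \<in> tube v n"
    unfolding tube_def using t by (intro CollectI exI[of _ "- t"]) auto
qed

lemma minkowski_tube: "minkowski (tube v n) v \<le> 1/2"
proof (rule dense_ge)
  fix r :: real assume r: "1/2 < r"
  then have "inverse r < 2" "0 < r"
    by (auto simp: field_simps)
  then have "inverse r *\<^sub>R v \<in> tube v n"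
    unfolding tube_def by (intro CollectI exI[of _ "inverse r"]) auto
  then show "minkowski (tube v n) v \<le> r"
    using minkowski_less_iff[OF disk_tube \<open>0 < r\<close>] by (simp add: less_imp_le)
qed

end

lemma cSUP_diff_le:
  fixes b b' :: "nat \<Rightarrow> real"
  assumes "bdd_above (range b)" "bdd_above (range b')" "\<And>i. \<bar>b i - b' i\<bar> \<le> e"
  shows "\<bar>(SUP i. b i) - (SUP i. b' i)\<bar> \<le> e"
proof -
  have "(SUP i. f i) \<le> (SUP i. g i) + e" if "bdd_above (range g)" "\<And>i. \<bar>f i - g i\<bar> \<le> e" for f g :: "nat \<Rightarrow> real"
  proof (rule cSUP_least)
    fix i
    have "g i \<le> (SUP i. g i)"
      using that by (intro cSUP_upper) auto
    then show "f i \<le> (SUP i. g i) + e"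
      using that(2)[of i] by linarith
  qed simp
  from this[of b' b] this[of b b'] show ?thesis
    using assms by (auto simp: abs_le_iff abs_minus_commute)
qed

text \<open>
  The sets \<open>Z i\<close> shrink to nothing inside \<open>B\<close>, so points chosen in them on distinct lines of
  direction \<open>v\<close> have a locally finite family of tubes along \<open>v\<close>, each missing all other points;
  every second point is pushed out of \<open>B\<close> along its tube.
\<close>

locale vanishing_sequence = disk_base C for C :: "nat \<Rightarrow> 'a::topological_real_vector set" +
  fixes v :: 'a and B X :: "'a set" and q :: nat and Z :: "nat \<Rightarrow> 'a set"
  assumes Z_open: "open (Z i)" and Z_nonempty: "Z i \<noteq> {}" and Z_subset: "Z i \<subseteq> B"
    and Z_decreasing: "closure (Z (Suc i)) \<subseteq> closure (Z i)"
    and Z_vanishing: "(\<Inter>i. closure (Z i)) = {}"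
    and B_thin: "z \<in> B \<Longrightarrow> z + t *\<^sub>R v \<in> B \<Longrightarrow> \<bar>t\<bar> < 1"
    and B_inside: "z \<in> B \<Longrightarrow> \<bar>t\<bar> < 2 \<Longrightarrow> d \<in> C q \<Longrightarrow> z + d + t *\<^sub>R v \<in> X"
    and open_X: "open X"
begin

lemma Z_antimono: "i \<le> j \<Longrightarrow> closure (Z j) \<subseteq> closure (Z i)"
  by (induction rule: dec_induct) (use Z_decreasing in auto)

lemma compact_misses:
  assumes "compact K"
  shows "\<exists>k. K \<inter> closure (Z k) = {}"
proof (rule ccontr)
  assume no: "\<nexists>k. K \<inter> closure (Z k) = {}"
  have "K \<inter> (\<Inter>i\<in>UNIV. closure (Z i)) \<noteq> {}"
  proof (rule compact_imp_fip_image[OF assms])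
    fix I :: "nat set" assume "finite I"
    then have "closure (Z (Max (insert 0 I))) \<subseteq> (\<Inter>i\<in>I. closure (Z i))"
      using Z_antimono by (meson INT_greatest Max_ge finite_insert insertI2)
    then show "K \<inter> (\<Inter>i\<in>I. closure (Z i)) \<noteq> {}"
      using no by blast
  qed auto
  then show False
    using Z_vanishing by simp
qed

text \<open>The axis of a tube centred at \<open>z\<close>, with its end points included for
  compactness.\<close>

definition seg :: "'a \<Rightarrow> 'a set" where
  "seg z = (\<lambda>t. z + t *\<^sub>R v) ` {- 2..2}"

lemma compact_seg: "compact (seg z)"
  unfolding seg_def
  by (intro compact_continuous_image continuous_intros continuous_on_scaleR_tvs compact_Icc)

text \<open>Were \<open>Z i\<close> covered by finitely many lines, \<open>B_thin\<close> would
  confine it to finitely many compact segments, and these miss \<open>closure (Z k)\<close> for some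
  \<open>k\<close>.\<close>

lemma off_lines:
  assumes "finite F"
  shows "\<exists>x\<in>Z i. \<forall>y\<in>F. \<forall>t. x \<noteq> y + t *\<^sub>R v"
proof (rule ccontr)
  assume "\<not> (\<exists>x\<in>Z i. \<forall>y\<in>F. \<forall>t. x \<noteq> y + t *\<^sub>R v)"
  then have no: "\<And>x. x \<in> Z i \<Longrightarrow> \<exists>y\<in>F. \<exists>t. x = y + t *\<^sub>R v"
    by blast
  \<comment> \<open>For a line that misses \<open>Z i\<close> the choice is arbitrary, which only
    adds a harmless compact segment to \<open>K\<close>.\<close>
  define r where "r y = (SOME x. x \<in> Z i \<and> (\<exists>t. x = y + t *\<^sub>R v))" for y
  define K where "K = (\<Union>y\<in>F. seg (r y))"
  have sub: "Z i \<subseteq> K"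
  proof
    fix x assume x: "x \<in> Z i"
    then obtain y t where y: "y \<in> F" "x = y + t *\<^sub>R v"
      using no by blast
    have "r y \<in> Z i \<and> (\<exists>t. r y = y + t *\<^sub>R v)"
      unfolding r_def by (rule someI[of _ x]) (use x y in auto)
    then obtain s where s: "r y \<in> Z i" "r y = y + s *\<^sub>R v"
      by blast
    have eq: "x = r y + (t - s) *\<^sub>R v"
      using y s by (simp add: algebra_simps)
    then have "\<bar>t - s\<bar> < 1"
      using B_thin[of "r y" "t - s"] Z_subset x s by auto
    then show "x \<in> K"
      unfolding K_def seg_def using y eq by (intro UN_I[of y] image_eqI[of _ _ "t - s"]) auto
  qed
  have "compact K"
    unfolding K_def using assms compact_seg by (intro compact_UN) auto
  then obtain k where k: "K \<inter> closure (Z k) = {}"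
    using compact_misses by blast
  define m where "m = max i k"
  \<comment> \<open>Only the closures decrease, so \<open>Z m\<close> need not lie in
    \<open>Z i\<close>; but it is open and therefore meets it.\<close>
  have "Z m \<inter> closure (Z i) \<noteq> {}"
    using Z_antimono[of i m] closure_subset[of "Z m"] Z_nonempty[of m] by (auto simp: m_def)
  then have "Z m \<inter> Z i \<noteq> {}"
    using open_Int_closure_eq_empty[OF Z_open] by blast
  moreover have "Z m \<subseteq> closure (Z k)"
    using Z_antimono[of k m] closure_subset[of "Z m"] by (auto simp: m_def)
  ultimately show False
    using k sub by blast
qed

text \<open>By \<open>i div 2\<close> each set receives two points: the even one will stay fixed,
  the odd one will be pushed.\<close>

lemma ex_points:
  "\<exists>x. (\<forall>i. x i \<in> Z (i div 2)) \<and> (\<forall>i j t. i \<noteq> j \<longrightarrow> x i \<noteq> x j + t *\<^sub>R v)"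
proof -
  have "\<exists>f. \<forall>n. (finite (fst (f n)) \<and> snd (f n) \<in> Z (n div 2) \<and>
        (\<forall>y\<in>fst (f n). \<forall>t. snd (f n) \<noteq> y + t *\<^sub>R v)) \<and>
      fst (f (Suc n)) = insert (snd (f n)) (fst (f n))"
  proof (rule dependent_nat_choice)
    show "\<exists>p. finite (fst p) \<and> snd p \<in> Z (0 div 2) \<and> (\<forall>y\<in>fst p. \<forall>t. snd p \<noteq> y + t *\<^sub>R v)"
      using off_lines[of "{}" 0] by (auto intro!: exI[of _ "{}"])
    fix p :: "'a set \<times> 'a" and n :: nat
    assume "finite (fst p) \<and> snd p \<in> Z (n div 2) \<and> (\<forall>y\<in>fst p. \<forall>t. snd p \<noteq> y + t *\<^sub>R v)"
    then have fin: "finite (insert (snd p) (fst p))"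
      by simp
    obtain x where "x \<in> Z (Suc n div 2)" "\<forall>y\<in>insert (snd p) (fst p). \<forall>t. x \<noteq> y + t *\<^sub>R v"
      using off_lines[OF fin] by blast
    then show "\<exists>p'. (finite (fst p') \<and> snd p' \<in> Z (Suc n div 2) \<and> (\<forall>y\<in>fst p'. \<forall>t. snd p' \<noteq> y + t *\<^sub>R v)) \<and>
        fst p' = insert (snd p) (fst p)"
      using fin by (intro exI[of _ "(insert (snd p) (fst p), x)"]) auto
  qed
  then obtain f where f: "\<And>n. snd (f n) \<in> Z (n div 2)"
      "\<And>n y t. y \<in> fst (f n) \<Longrightarrow> snd (f n) \<noteq> y + t *\<^sub>R v"
      "\<And>n. fst (f (Suc n)) = insert (snd (f n)) (fst (f n))"
    by metis
  have mem: "snd (f j) \<in> fst (f i)" if "j < i" for i j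
    using that by (induction i) (auto simp: f(3) less_Suc_eq)
  have "snd (f i) \<noteq> snd (f j) + t *\<^sub>R v" if "i \<noteq> j" for i j t
  proof (cases "j < i")
    case False
    then have "snd (f j) \<noteq> snd (f i) + (- t) *\<^sub>R v"
      using f(2) mem that by (meson linorder_neqE_nat)
    then show ?thesis
      by (simp add: algebra_simps)
  qed (use f(2) mem in blast)
  then show ?thesis
    using f(1) by (intro exI[of _ "\<lambda>n. snd (f n)"]) auto
qed

lemma ex_shear:
  "\<exists>\<phi>. shear C \<phi> v (1/2) X \<and> (\<forall>i. \<exists>y\<in>Z i. \<exists>z\<in>Z i. \<phi> y = 0 \<and> \<phi> z = 1)"
proof -
  obtain x where x: "\<And>i. x i \<in> Z (i div 2)" "\<And>i j t. i \<noteq> j \<Longrightarrow> x i \<noteq> x j + t *\<^sub>R v"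
    using ex_points by blast
  \<comment> \<open>Here \<open>i \<le> n\<close> forces the tubes to become thin, for local
    finiteness, and \<open>q \<le> n\<close> keeps them inside \<open>X\<close>.\<close>
  have "\<exists>n. i \<le> n \<and> q \<le> n \<and> (\<forall>j. j \<noteq> i \<longrightarrow> x j - x i \<notin> tube v n)" for i
  proof -
    obtain k where k: "seg (x i) \<inter> closure (Z k) = {}"
      using compact_misses[OF compact_seg] by blast
    \<comment> \<open>All points of index at least \<open>2 * k\<close> lie in
      \<open>closure (Z k)\<close>; the finitely many remaining ones are off the line through
      \<open>x i\<close>.\<close>
    define A where "A = closure (Z k) \<union> x ` ({..<2 * k} - {i})"
    have "closed A"
      unfolding A_def by (intro closed_Un closed_closure closed_finite) auto
    moreover have "seg (x i) \<inter> A = {}"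
    proof -
      have "x j \<notin> seg (x i)" if "j \<noteq> i" for j
        using x(2)[OF that] by (auto simp: seg_def)
      then show ?thesis
        using k by (auto simp: A_def)
    qed
    ultimately obtain n where n: "\<And>u y. u \<in> seg (x i) \<Longrightarrow> y - u \<in> C n \<Longrightarrow> y \<notin> A"
      using compact_closed_gap[OF compact_seg] by blast
    have A: "x j \<in> A" if "j \<noteq> i" for j
    proof (cases "j < 2 * k")
      case False
      then have "closure (Z (j div 2)) \<subseteq> closure (Z k)"
        by (intro Z_antimono) auto
      then show ?thesis
        using x(1)[of j] closure_subset[of "Z (j div 2)"] by (auto simp: A_def)
    qed (use that in \<open>auto simp: A_def\<close>)
    define m where "m = n + i + q"
    have "x j - x i \<notin> tube v m" if "j \<noteq> i" for j
    proof
      assume "x j - x i \<in> tube v m"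
      then obtain t where t: "\<bar>t\<bar> < 2" "x j - x i - t *\<^sub>R v \<in> C m"
        by (auto simp: tube_def)
      then have "x j - (x i + t *\<^sub>R v) \<in> C n"
        using C_antimono[of n m] by (auto simp: m_def diff_diff_eq)
      moreover have "x i + t *\<^sub>R v \<in> seg (x i)"
        unfolding seg_def using t by (intro image_eqI[of _ _ t]) auto
      ultimately show False
        using n A that by blast
    qed
    then show ?thesis
      by (intro exI[of _ m]) (auto simp: m_def)
  qed
  then obtain n where n: "\<And>i. i \<le> n i" "\<And>i. q \<le> n i" "\<And>i j. j \<noteq> i \<Longrightarrow> x j - x i \<notin> tube v (n i)"
    by metis
  define b where "b i = bump (tube v (n (2 * i + 1))) (x (2 * i + 1))" for i
  \<comment> \<open>A supremum instead of a sum: even where tubes overlap, values stay in the unit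
    interval and the slope along \<open>v\<close> stays at most 1/2.\<close>
  define \<phi> where "\<phi> y = (SUP i. b i y)" for y
  have b_range: "0 \<le> b i y" "b i y \<le> 1" for i y
    using bump_range[OF disk_tube] by (auto simp: b_def)
  have bdd: "bdd_above (range (\<lambda>i. b i y))" for y
    using b_range by (intro bdd_aboveI[of _ 1]) auto
  have b_le: "b i y \<le> \<phi> y" for i y
    unfolding \<phi>_def using bdd by (intro cSUP_upper) auto
  have phi_le: "\<phi> y \<le> 1" for y
    unfolding \<phi>_def using b_range by (intro cSUP_least) auto
  have phi_diff: "\<bar>\<phi> y - \<phi> z\<bar> \<le> e" if "\<And>i. \<bar>b i y - b i z\<bar> \<le> e" for y z e
    unfolding \<phi>_def using bdd that by (intro cSUP_diff_le) auto
  have phi_zero: "\<phi> y = 0" if "\<And>i. b i y = 0" for y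
    unfolding \<phi>_def using that by simp
  have "shear C \<phi> v (1/2) X"
  proof
    show "0 \<le> \<phi> y" "\<phi> y \<le> 1" for y
      using b_le[of 0 y] b_range[of 0 y] phi_le by auto
    show "\<bar>\<phi> (y + t *\<^sub>R v) - \<phi> y\<bar> \<le> 1/2 * \<bar>t\<bar>" for y t
    proof (rule phi_diff)
      fix i
      have "\<bar>b i (y + t *\<^sub>R v) - b i y\<bar> \<le> \<bar>t\<bar> * minkowski (tube v (n (2 * i + 1))) v"
        using bump_diff[OF disk_tube, of v "n (2 * i + 1)" "x (2 * i + 1)" "y + t *\<^sub>R v" y]
        by (simp add: b_def minkowski_scaleR[OF disk_tube])
      also have "\<dots> \<le> \<bar>t\<bar> * (1/2)"
        by (intro mult_left_mono minkowski_tube) auto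
      finally show "\<bar>b i (y + t *\<^sub>R v) - b i y\<bar> \<le> 1/2 * \<bar>t\<bar>"
        by simp
    qed
    show "y \<in> X" if "\<phi> y \<noteq> 0" for y
    proof -
      obtain i where "b i y \<noteq> 0"
        using \<open>\<phi> y \<noteq> 0\<close> phi_zero by blast
      then have "y - x (2 * i + 1) \<in> tube v (n (2 * i + 1))"
        unfolding b_def using bump_nonzero_iff[OF disk_tube] by blast
      then obtain t where t: "\<bar>t\<bar> < 2" "y - x (2 * i + 1) - t *\<^sub>R v \<in> C (n (2 * i + 1))"
        by (auto simp: tube_def)
      have "x (2 * i + 1) + (y - x (2 * i + 1) - t *\<^sub>R v) + t *\<^sub>R v \<in> X"
        using C_antimono[OF n(2)] t x(1)[of "2 * i + 1"] Z_subset by (intro B_inside) auto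
      then show ?thesis
        by simp
    qed
    show "\<exists>m. \<forall>e>0. \<exists>l. \<forall>y z. y - u \<in> C m \<longrightarrow> z - u \<in> C m \<longrightarrow> z - y \<in> C l \<longrightarrow> \<bar>\<phi> z - \<phi> y\<bar> < e" for u
    proof -
      obtain k where k: "seg u \<inter> closure (Z k) = {}"
        using compact_misses[OF compact_seg] by blast
      obtain m where m: "\<And>w y. w \<in> seg u \<Longrightarrow> y - w \<in> C m \<Longrightarrow> y \<notin> closure (Z k)"
        using compact_closed_gap[OF compact_seg closed_closure k] by blast
      \<comment> \<open>Beyond \<open>N\<close> the tubes are so thin that one reaching the
        neighbourhood of \<open>u\<close> would have its centre near the segment through
        \<open>u\<close>, where \<open>closure (Z k)\<close> has no points.\<close>
      define N where "N = max k (Suc m)"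
      have b0: "b i y = 0" if y: "y - u \<in> C (Suc m)" and i: "N \<le> i" for i y
      proof (rule ccontr)
        let ?j = "2 * i + 1"
        assume "b i y \<noteq> 0"
        then have "y - x ?j \<in> tube v (n ?j)"
          unfolding b_def using bump_nonzero_iff[OF disk_tube] by blast
        then obtain t where t: "\<bar>t\<bar> < 2" "y - x ?j - t *\<^sub>R v \<in> C (n ?j)"
          by (auto simp: tube_def)
        have "Suc m \<le> n ?j"
          using i n(1)[of ?j] by (simp add: N_def)
        then have "y - x ?j - t *\<^sub>R v \<in> C (Suc m)"
          using C_antimono[of "Suc m" "n ?j"] t(2) by blast
        then have "(y - u) - (y - x ?j - t *\<^sub>R v) \<in> C m"
          by (rule C_diff[OF y])
        then have "x ?j - (u + (- t) *\<^sub>R v) \<in> C m"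
          by (simp add: algebra_simps)
        moreover have "u + (- t) *\<^sub>R v \<in> seg u"
          unfolding seg_def using t by (intro image_eqI[of _ _ "- t"]) auto
        ultimately have "x ?j \<notin> closure (Z k)"
          using m by blast
        moreover have "closure (Z i) \<subseteq> closure (Z k)"
          using i by (intro Z_antimono) (auto simp: N_def)
        moreover have "x ?j \<in> Z i"
          using x(1)[of ?j] by simp
        ultimately show False
          using closure_subset[of "Z i"] by blast
      qed
      show ?thesis
      proof (rule exI[of _ "Suc m"], intro allI impI)
        fix e :: real assume "0 < e"
        then have "\<forall>i. \<exists>l. \<forall>d\<in>C l. minkowski (tube v (n (2 * i + 1))) d < e / 2"
          using minkowski_small[OF disk_tube half_gt_zero] by blast
        then obtain l where l: "\<And>i d. d \<in> C (l i) \<Longrightarrow> minkowski (tube v (n (2 * i + 1))) d < e / 2"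
          by metis
        \<comment> \<open>Only tents of index below \<open>N\<close> vary near \<open>u\<close>, so
          the largest of finitely many indices \<open>l i\<close> serves them all.\<close>
        show "\<exists>l. \<forall>y z. y - u \<in> C (Suc m) \<longrightarrow> z - u \<in> C (Suc m) \<longrightarrow> z - y \<in> C l \<longrightarrow> \<bar>\<phi> z - \<phi> y\<bar> < e"
        proof (intro exI allI impI)
          fix y z assume yz: "y - u \<in> C (Suc m)" "z - u \<in> C (Suc m)" "z - y \<in> C (Max (l ` {..N}))"
          have "\<bar>\<phi> z - \<phi> y\<bar> \<le> e / 2"
          proof (rule phi_diff)
            fix i
            show "\<bar>b i z - b i y\<bar> \<le> e / 2"
            proof (cases "N \<le> i")
              case True
              then show ?thesis
                using b0 yz \<open>0 < e\<close> by simp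
            next
              case False
              then have "l i \<le> Max (l ` {..N})"
                by (intro Max_ge) auto
              then have "z - y \<in> C (l i)"
                using C_antimono[of "l i" "Max (l ` {..N})"] yz(3) by blast
              then have "minkowski (tube v (n (2 * i + 1))) (z - y) < e / 2"
                by (rule l)
              then show ?thesis
                using bump_diff[OF disk_tube, of v "n (2 * i + 1)" "x (2 * i + 1)" z y]
                by (simp add: b_def)
            qed
          qed
          then show "\<bar>\<phi> z - \<phi> y\<bar> < e"
            using \<open>0 < e\<close> by simp
        qed
      qed
    qed
    show "open X" "1/2 < (1::real)"
      using open_X by auto
  qed
  moreover have "\<exists>y\<in>Z i. \<exists>z\<in>Z i. \<phi> y = 0 \<and> \<phi> z = 1" for i
  proof -
    have mem: "x (2 * i) \<in> Z i" "x (2 * i + 1) \<in> Z i"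
      using x(1)[of "2 * i"] x(1)[of "2 * i + 1"] by auto
    have zero: "\<phi> (x (2 * i)) = 0"
    proof (rule phi_zero)
      fix j
      have "2 * i \<noteq> 2 * j + 1"
        by presburger
      then show "b j (x (2 * i)) = 0"
        using n(3) bump_nonzero_iff[OF disk_tube] unfolding b_def by blast
    qed
    have "b i (x (2 * i + 1)) = 1"
      unfolding b_def by (rule bump_center[OF disk_tube])
    then have "\<phi> (x (2 * i + 1)) = 1"
      using b_le[of i "x (2 * i + 1)"] phi_le[of "x (2 * i + 1)"] by linarith
    then show ?thesis
      using mem zero by blast
  qed
  ultimately show ?thesis
    by blast
qed

end

section \<open>Open subsets of locally convex metrizable spaces\<close>

lemma disk_half:
  fixes U :: "'a::topological_real_vector set"
  assumes lc: "locally_convex_space TYPE('a)" and U: "open U" "0 \<in> U"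
  shows "\<exists>D. disk D \<and> (\<forall>x\<in>D. \<forall>y\<in>D. x + y \<in> U)"
proof -
  have "continuous_on UNIV (\<lambda>p::'a \<times> 'a. fst p + snd p)"
    by (intro continuous_intros)
  then have "open ((\<lambda>p::'a \<times> 'a. fst p + snd p) -` U)"
    using U by (intro open_vimage)
  moreover have "(0, 0) \<in> (\<lambda>p::'a \<times> 'a. fst p + snd p) -` U"
    using U by simp
  ultimately obtain A B where AB: "open A" "open B" "(0, 0) \<in> A \<times> B"
      "A \<times> B \<subseteq> (\<lambda>p::'a \<times> 'a. fst p + snd p) -` U"
    by (rule open_prod_elim)
  then obtain V where V: "open V" "convex V" "0 \<in> V" "V \<subseteq> A \<inter> B"
    using lc unfolding locally_convex_space_def by (metis IntI mem_Sigma_iff open_Int)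
  define D where "D = V \<inter> uminus -` V"
  have "open (uminus -` V)"
    by (intro open_vimage V continuous_intros)
  moreover have "convex D"
  proof (rule convexI)
    fix x y :: 'a and u w :: real
    assume *: "x \<in> D" "y \<in> D" "0 \<le> u" "0 \<le> w" "u + w = 1"
    then have "u *\<^sub>R x + w *\<^sub>R y \<in> V" "u *\<^sub>R (- x) + w *\<^sub>R (- y) \<in> V"
      by (auto simp: D_def intro!: convexD[OF V(2)] simp del: scaleR_minus_right)
    then show "u *\<^sub>R x + w *\<^sub>R y \<in> D"
      by (simp add: D_def)
  qed
  ultimately have "disk D"
    unfolding disk_def using V by (auto simp: D_def)
  moreover have "x + y \<in> U" if "x \<in> D" "y \<in> D" for x y
  proof -
    have "(x, y) \<in> A \<times> B"
      using that V by (auto simp: D_def)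
    then show ?thesis
      using AB(4) by auto
  qed
  ultimately show ?thesis
    by blast
qed

text \<open>The metric is not assumed to be translation invariant; its balls at zero merely supply a
  countable base, inside which disks are chosen recursively.\<close>

lemma ex_disk_base:
  assumes lc: "locally_convex_space TYPE('a::topological_real_vector)"
    and metr: "metrizable_space (euclidean :: 'a topology)"
  shows "\<exists>C :: nat \<Rightarrow> 'a set. disk_base C"
proof -
  obtain M d where Md: "Metric_space M d" "(euclidean :: 'a topology) = Metric_space.mtopology M d"
    using metr by (auto simp: metrizable_space_def)
  interpret Metric_space M d
    by (rule Md)
  have M: "M = UNIV"
    using topspace_mtopology Md(2) by (metis topspace_euclidean)
  define B where "B n = mball (0::'a) (inverse (real (Suc n)))" for n
  have "0 \<in> M"
    by (simp add: M)
  then have B: "open (B n)" "0 \<in> B n" for n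
    unfolding B_def open_openin Md(2) by auto
  have B_base: "\<exists>n. B n \<subseteq> U" if U: "open U" "0 \<in> U" for U
  proof -
    obtain r where r: "r > 0" "mball 0 r \<subseteq> U"
      using U unfolding open_openin Md(2) openin_mtopology by blast
    obtain n where "inverse (real (Suc n)) < r"
      using reals_Archimedean[OF r(1)] by blast
    then have "B n \<subseteq> mball 0 r"
      unfolding B_def by (intro mball_subset_concentric) simp
    then show ?thesis
      using r by blast
  qed
  have "\<exists>C. \<forall>n. (disk (C n) \<and> C n \<subseteq> B n) \<and> (\<forall>x\<in>C (Suc n). \<forall>y\<in>C (Suc n). x + y \<in> C n)"
  proof (rule dependent_nat_choice)
    obtain D :: "'a set" where D: "disk D" "\<forall>x\<in>D. \<forall>y\<in>D. x + y \<in> B 0"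
      using disk_half[OF lc B] by blast
    then have "D \<subseteq> B 0"
      by (metis add.right_neutral disk_def subsetI)
    then show "\<exists>D. disk D \<and> D \<subseteq> B 0"
      using D by blast
  next
    fix D n assume D: "disk D \<and> D \<subseteq> B n"
    then have "open (D \<inter> B (Suc n))" "0 \<in> D \<inter> B (Suc n)"
      using B by (auto simp: disk_def)
    then obtain D' where D': "disk D'" "\<forall>x\<in>D'. \<forall>y\<in>D'. x + y \<in> D \<inter> B (Suc n)"
      using disk_half[OF lc] by blast
    then have "D' \<subseteq> B (Suc n)"
      by (metis IntD2 add.right_neutral disk_def subsetI)
    then show "\<exists>D'. (disk D' \<and> D' \<subseteq> B (Suc n)) \<and> (\<forall>x\<in>D'. \<forall>y\<in>D'. x + y \<in> D)"
      using D' by blast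
  qed
  then obtain C where C: "\<And>n. disk (C n)" "\<And>n. C n \<subseteq> B n"
      "\<And>n x y. x \<in> C (Suc n) \<Longrightarrow> y \<in> C (Suc n) \<Longrightarrow> x + y \<in> C n"
    by metis
  have C_base: "\<exists>n. C n \<subseteq> U" if "open U" "0 \<in> U" for U
    using B_base[OF that] C(2) by blast
  have "disk_base C"
  proof
    fix x :: 'a assume "x \<noteq> 0"
    moreover have "Hausdorff_space (euclidean :: 'a topology)"
      using metr by (rule metrizable_imp_Hausdorff_space)
    ultimately obtain U V where "open U" "0 \<in> U" "x \<in> V" "disjnt U V"
      unfolding Hausdorff_space_def by (metis UNIV_I open_openin topspace_euclidean)
    then show "\<exists>n. x \<notin> C n"
      using C_base[of U] by (auto simp: disjnt_iff)
  qed (use C C_base in auto)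
  then show ?thesis
    by blast
qed

text \<open>\<open>nontrivial\<close> excludes the zero space, where no nonempty open set supports a
  nontrivial homeomorphism.\<close>

locale lc_pair = disk_base C for C :: "nat \<Rightarrow> 'a::topological_real_vector set" +
  fixes X :: "'a set" and G :: "('a \<Rightarrow> 'a) set"
  assumes open_X: "open X"
    and nontrivial: "\<exists>v::'a. v \<noteq> 0"
    and subgroup_G: "subgroup G (homeo_group (top_of_set X))"
    and uniform_in_G: "\<And>h. h \<in> carrier (homeo_group (top_of_set X)) \<Longrightarrow>
      locally_bi_uniformly_continuous X h \<Longrightarrow> h \<in> G"
begin

abbreviation GG :: "('a \<Rightarrow> 'a) monoid" where
  "GG \<equiv> homeo_group (top_of_set X) \<lparr>carrier := G\<rparr>"

lemma G_homeo:
  assumes "g \<in> G"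
  shows "g \<in> Bij X" "homeomorphic_map (top_of_set X) (top_of_set X) g"
  using subgroup.subset[OF subgroup_G] assms by (auto simp: homeo_group_def)

lemma G_mult: "g \<in> G \<Longrightarrow> h \<in> G \<Longrightarrow> g \<otimes>\<^bsub>GG\<^esub> h = compose X g h"
  using G_homeo by (simp add: homeo_group_def BijGroup_def)

lemma G_one: "\<one>\<^bsub>GG\<^esub> = (\<lambda>x\<in>X. x)"
  by (simp add: homeo_group_def BijGroup_def)

lemma group_GG: "group GG"
  using subgroup.subgroup_is_group[OF subgroup_G group_homeo_group] .

lemma shear_in_G:
  assumes "shear C \<phi> v c X"
  shows "\<exists>h\<in>G. \<forall>x\<in>X. h x = x + \<phi> x *\<^sub>R v"
proof -
  interpret shear C \<phi> v c X
    by (rule assms)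
  show ?thesis
    using uniform_in_G[OF restrict_h_homeo restrict_h_uniform]
    by (intro bexI[of _ "restrict h X"]) (auto simp: h_def)
qed

text \<open>Membership \<open>v \<in> D\<close> means that \<open>v\<close> has gauge below 1, and
  this gauge is the Lipschitz constant of the tent along \<open>v\<close>.\<close>

lemma bump_in_G:
  assumes D: "disk D" "v \<in> D" and DX: "\<And>y. y - a \<in> D \<Longrightarrow> y \<in> X"
  shows "\<exists>h\<in>G. \<forall>x\<in>X. h x = x + bump D a x *\<^sub>R v"
proof (rule shear_in_G)
  show "shear C (bump D a) v (minkowski D v) X"
  proof
    show "0 \<le> bump D a x" "bump D a x \<le> 1" for x
      using bump_range[OF D(1)] by auto
    show "minkowski D v < 1"
      using D minkowski_less_iff[of D 1 v] by simp
    show "\<bar>bump D a (x + t *\<^sub>R v) - bump D a x\<bar> \<le> minkowski D v * \<bar>t\<bar>" for x t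
      using bump_diff[OF D(1), of a "x + t *\<^sub>R v" x] by (simp add: minkowski_scaleR[OF D(1)] mult.commute)
    show "x \<in> X" if "bump D a x \<noteq> 0" for x
      using that bump_nonzero_iff[OF D(1)] DX by blast
    show "\<exists>n. \<forall>e>0. \<exists>m. \<forall>y z. y - x \<in> C n \<longrightarrow> z - x \<in> C n \<longrightarrow> z - y \<in> C m \<longrightarrow>
        \<bar>bump D a z - bump D a y\<bar> < e" for x
      using minkowski_small[OF D(1)] bump_diff[OF D(1)] by (meson le_less_trans)
  qed (rule open_X)
qed

lemma small_vector:
  obtains v where "v \<noteq> 0" "v \<in> C n"
proof -
  obtain w :: 'a where w: "w \<noteq> 0"
    using nontrivial by blast
  obtain e where "0 < e" "\<And>t. \<bar>t\<bar> < e \<Longrightarrow> t *\<^sub>R w \<in> C n"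
    using small_multiple by blast
  then show thesis
    using that[of "(e / 2) *\<^sub>R w"] w by simp
qed

lemma hausdorff: "hausdorff_on S" for S :: "'a set"
  unfolding hausdorff_on_def
proof (intro ballI impI)
  fix x y :: 'a assume "x \<noteq> y"
  then obtain n where n: "y - x \<notin> C n"
    using C_separating[of "y - x"] by auto
  have "{z. z - x \<in> C (Suc n)} \<inter> {z. z - y \<in> C (Suc n)} = {}"
  proof (rule equals0I)
    fix z assume "z \<in> {z. z - x \<in> C (Suc n)} \<inter> {z. z - y \<in> C (Suc n)}"
    then have "(z - x) - (z - y) \<in> C n"
      using C_diff[of "z - x" n "z - y"] by blast
    then show False
      using n by simp
  qed
  then show "\<exists>U V. open U \<and> open V \<and> x \<in> U \<and> y \<in> V \<and> U \<inter> V = {}"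
    using open_C_translate[of x "Suc n"] open_C_translate[of y "Suc n"]
    by (intro exI[of _ "{z. z - x \<in> C (Suc n)}"] exI[of _ "{z. z - y \<in> C (Suc n)}"]) auto
qed

lemma small_supports_G: "small_supports GG X"
proof (intro small_supports.intro small_supports_axioms.intro group_GG open_X hausdorff)
  show "g x \<in> X" if "g \<in> carrier GG" "x \<in> X" for g x
    using that G_homeo(1)[of g] by (auto simp: Bij_def dest: bij_betwE)
  show "(g \<otimes>\<^bsub>GG\<^esub> h) x = g (h x)" if "g \<in> carrier GG" "h \<in> carrier GG" "x \<in> X" for g h x
    using that G_mult[of g h] by (simp add: compose_eq)
  show "\<one>\<^bsub>GG\<^esub> x = x" if "x \<in> X" for x
    using that G_one by simp
  show "g = h" if "g \<in> carrier GG" "h \<in> carrier GG" "\<And>x. x \<in> X \<Longrightarrow> g x = h x" for g h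
    using that G_homeo(1)[of g] G_homeo(1)[of h]
    by (intro extensionalityI[of g X h]) (auto dest: Bij_imp_extensional)
  show "continuous_on X g" if "g \<in> carrier GG" for g
    using that G_homeo(2)[of g] homeomorphic_imp_continuous_map by fastforce
  fix U :: "'a set" assume U: "open U" "U \<noteq> {}" "U \<subseteq> X"
  then obtain p where p: "p \<in> U"
    by blast
  obtain n where n: "\<And>y. y - p \<in> C n \<Longrightarrow> y \<in> U"
    using nbhd_C[OF U(1) p] by blast
  obtain v where v: "v \<noteq> 0" "v \<in> C n"
    using small_vector by blast
  obtain h where h: "h \<in> G" "\<And>x. x \<in> X \<Longrightarrow> h x = x + bump (C n) p x *\<^sub>R v"
    using bump_in_G[OF disk_C v(2) subsetD[OF U(3) n]] by blast
  have hX: "h x \<in> X" if "x \<in> X" for x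
    using that h G_homeo(1)[of h] by (auto simp: Bij_def dest: bij_betwE)
  interpret GG: group GG
    by (rule group_GG)
  have pow_Suc: "(h [^]\<^bsub>GG\<^esub> Suc k) x = (h [^]\<^bsub>GG\<^esub> k) (h x)" if "x \<in> X" for x and k :: nat
    using G_mult[of "h [^]\<^bsub>GG\<^esub> k" h] GG.nat_pow_closed[of h k] h(1) that by (simp add: compose_eq)
  \<comment> \<open>All displacements are nonnegative multiples of the same vector and cannot
    cancel, so no positive power of \<open>h\<close> fixes the centre \<open>p\<close>.\<close>
  have pow: "\<exists>s\<ge>0. (h [^]\<^bsub>GG\<^esub> k) x = x + s *\<^sub>R v" if "x \<in> X" for x and k :: nat
    using that
  proof (induction k arbitrary: x)
    case 0
    then show ?case
      using G_one by (auto intro!: exI[of _ 0])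
  next
    case (Suc k)
    obtain s where s: "0 \<le> s" "(h [^]\<^bsub>GG\<^esub> k) (h x) = h x + s *\<^sub>R v"
      using Suc hX by blast
    have "(h [^]\<^bsub>GG\<^esub> Suc k) x = (h [^]\<^bsub>GG\<^esub> k) (h x)"
      using pow_Suc Suc.prems by blast
    also have "\<dots> = x + (bump (C n) p x + s) *\<^sub>R v"
      using s h Suc.prems by (simp add: algebra_simps)
    finally show ?case
      using s bump_range[OF disk_C, of n p x] by (intro exI[of _ "bump (C n) p x + s"]) auto
  qed
  have "h [^]\<^bsub>GG\<^esub> (12::nat) \<noteq> \<one>\<^bsub>GG\<^esub>"
  proof
    assume "h [^]\<^bsub>GG\<^esub> (12::nat) = \<one>\<^bsub>GG\<^esub>"
    moreover have "(12::nat) = Suc 11"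
      by simp
    ultimately have one: "h [^]\<^bsub>GG\<^esub> Suc 11 = \<one>\<^bsub>GG\<^esub>"
      by metis
    have pX: "p \<in> X"
      using p U by blast
    obtain s where s: "0 \<le> s" "(h [^]\<^bsub>GG\<^esub> (11::nat)) (h p) = h p + s *\<^sub>R v"
      using pow hX pX by blast
    have "(h [^]\<^bsub>GG\<^esub> Suc 11) p = (h [^]\<^bsub>GG\<^esub> (11::nat)) (h p)"
      using pow_Suc pX by blast
    also have "\<dots> = p + (1 + s) *\<^sub>R v"
      using s h pX bump_center[OF disk_C, of n p] by (simp add: algebra_simps)
    finally have "p = p + (1 + s) *\<^sub>R v"
      unfolding one G_one using pX by simp
    then show False
      using s v by simp
  qed
  moreover have "{x\<in>X. h x \<noteq> x} \<subseteq> U"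
    using h n bump_nonzero_iff[OF disk_C, of n p] by auto
  ultimately show "\<exists>g\<in>carrier GG. {x\<in>X. g x \<noteq> x} \<subseteq> U \<and> g [^]\<^bsub>GG\<^esub> (12::nat) \<noteq> \<one>\<^bsub>GG\<^esub>"
    using h by auto
qed

sublocale small: small_supports GG X
  by (rule small_supports_G)

lemma supp_bump:
  assumes "h \<in> G" "\<And>x. x \<in> X \<Longrightarrow> h x = x + bump (C n) a x *\<^sub>R v" "v \<noteq> 0"
    "\<And>y. y - a \<in> C n \<Longrightarrow> y \<in> X"
  shows "small.supp h = {y. y - a \<in> C n}"
proof -
  have "h x \<noteq> x \<longleftrightarrow> x - a \<in> C n" if "x \<in> X" for x
    using assms(2)[OF that] assms(3) bump_nonzero_iff[OF disk_C, of n a x] by simp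
  then show ?thesis
    using assms(4) by (auto simp: small.supp_def)
qed

lemma locally_moving_G: "locally_moving GG X"
proof (intro locally_moving.intro locally_moving_axioms.intro small_supports_G)
  fix U x assume U: "open U" "U \<subseteq> X" "x \<in> U"
  obtain n where n: "\<And>y. y - x \<in> C n \<Longrightarrow> y \<in> U"
    using nbhd_C[OF U(1,3)] by blast
  have "\<exists>g\<in>carrier GG. small.supp g \<subseteq> U \<and> g x = y" if y: "y - x \<in> C n" for y
  proof -
    \<comment> \<open>The tent has height 1 at \<open>x\<close>, so a push along
      \<open>y - x\<close> sends \<open>x\<close> to \<open>y\<close>.\<close>
    obtain h where h: "h \<in> G" "\<And>z. z \<in> X \<Longrightarrow> h z = z + bump (C n) x z *\<^sub>R (y - x)"
      using bump_in_G[OF disk_C y subsetD[OF U(2) n]] by blast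
    have "small.supp h \<subseteq> U"
      using h n bump_nonzero_iff[OF disk_C, of n x] by (auto simp: small.supp_def)
    moreover have "h x = y"
      using h U bump_center[OF disk_C, of n x] by auto
    ultimately show ?thesis
      using h by auto
  qed
  then show "\<exists>W. open W \<and> x \<in> W \<and> W \<subseteq> U \<and> (\<forall>y\<in>W. \<exists>g\<in>carrier GG. small.supp g \<subseteq> U \<and> g x = y)"
    using n open_C_translate[of x n] by (intro exI[of _ "{y. y - x \<in> C n}"]) auto
next
  fix x assume x: "x \<in> X"
  obtain n where n: "\<And>y. y - x \<in> C n \<Longrightarrow> y \<in> X"
    using nbhd_C[OF open_X x] by blast
  have nk: "y \<in> X" if "y - x \<in> C (n + k)" for y k
    using n that C_antimono[of n "n + k"] by auto
  have "\<exists>h\<in>G. small.supp h = {y. y - x \<in> C (n + k)}" for k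
  proof -
    obtain v where v: "v \<noteq> 0" "v \<in> C (n + k)"
      using small_vector by blast
    obtain h where "h \<in> G" "\<And>z. z \<in> X \<Longrightarrow> h z = z + bump (C (n + k)) x z *\<^sub>R v"
      using bump_in_G[OF disk_C v(2) nk[of _ k]] by blast
    then show ?thesis
      using supp_bump v nk by blast
  qed
  then obtain f where f: "\<And>k. f k \<in> G" "\<And>k. small.supp (f k) = {y. y - x \<in> C (n + k)}"
    by metis
  have "\<exists>k. closure (small.supp (f k)) \<subseteq> U" if U: "open U" "x \<in> U" for U
  proof -
    obtain m where m: "\<And>y. y - x \<in> C m \<Longrightarrow> y \<in> U"
      using nbhd_C[OF U] by blast
    have "closure (small.supp (f (Suc m))) \<subseteq> U"
    proof
      fix z assume "z \<in> closure (small.supp (f (Suc m)))"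
      then obtain a where "a - x \<in> C (n + Suc m)" "z - a \<in> C (Suc m)"
        using closure_C f by (metis mem_Collect_eq)
      then have "(z - a) + (a - x) \<in> C m"
        using C_antimono[of "Suc m" "n + Suc m"] by (intro C_add) auto
      then show "z \<in> U"
        using m by simp
    qed
    then show ?thesis ..
  qed
  moreover have "C (n + Suc k) \<subseteq> C (n + k)" for k
    by (rule C_antimono) simp
  ultimately show "\<exists>f. (\<forall>k::nat. f k \<in> carrier GG \<and> x \<in> small.supp (f k) \<and>
      small.supp (f (Suc k)) \<subseteq> small.supp (f k)) \<and>
      (\<forall>U. open U \<and> x \<in> U \<longrightarrow> (\<exists>k. closure (small.supp (f k)) \<subseteq> U))"
    using f by (intro exI[of _ f]) auto
next
  fix p assume p: "p \<in> X"
  obtain q where q: "\<And>y. y - p \<in> C q \<Longrightarrow> y \<in> X"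
    using nbhd_C[OF open_X p] by blast
  \<comment> \<open>The index makes \<open>v + v\<close> an element of \<open>C (q + 2)\<close>, so
    tubes along \<open>v\<close> around \<open>closure W\<close> stay in \<open>X\<close>.\<close>
  obtain v where v: "v \<noteq> 0" "v \<in> C (Suc (q + 2))"
    using small_vector by blast
  obtain l where l: "v \<notin> C l"
    using C_separating[OF v(1)] by blast
  \<comment> \<open>\<open>L\<close> is at least \<open>l + 2\<close> and \<open>q + 3\<close>. In
    both one index is spent on passing to the closure of \<open>W\<close>; a further one up to
    \<open>l\<close> serves differences of points, and two down from \<open>q + 2\<close> to
    \<open>q\<close> pay for leaving the axis and moving along it.\<close>
  define L where "L = l + q + 3"
  define W where "W = {y. y - p \<in> C L}"
  have L: "C L \<subseteq> C (Suc (Suc l))" "C L \<subseteq> C (Suc (q + 2))"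
    by (intro C_antimono; simp add: L_def)+
  have clW: "z - p \<in> C (Suc l) \<and> z - p \<in> C (q + 2)" if z: "z \<in> closure W" for z
  proof -
    obtain a where a: "a \<in> W" "z - a \<in> C L"
      by (rule closure_C[OF z])
    then have "z - a \<in> C (Suc (Suc l))" "a - p \<in> C (Suc (Suc l))"
        "z - a \<in> C (Suc (q + 2))" "a - p \<in> C (Suc (q + 2))"
      using L by (auto simp: W_def)
    then have "(z - a) + (a - p) \<in> C (Suc l)" "(z - a) + (a - p) \<in> C (q + 2)"
      by (blast intro: C_add)+
    then show ?thesis
      by simp
  qed
  have clX: "closure W \<subseteq> X"
    using clW q C_antimono[of q "q + 2"] by auto
  have two_v: "v + v \<in> C (q + 2)"
    using v(2) by (blast intro: C_add)
  have thin: "\<bar>t\<bar> < 1" if "z \<in> closure W" "z + t *\<^sub>R v \<in> closure W" for z t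
  proof (rule ccontr)
    assume t: "\<not> \<bar>t\<bar> < 1"
    have "(z + t *\<^sub>R v - p) - (z - p) \<in> C l"
      by (rule C_diff) (use clW that in auto)
    then have "t *\<^sub>R v \<in> C l"
      by simp
    then have "(1 / t) *\<^sub>R (t *\<^sub>R v) \<in> C l"
      using disk_scaleR[OF disk_C, of "t *\<^sub>R v" l "1 / t"] t by simp
    then show False
      using l t by (cases "t = 0") auto
  qed
  have inside: "z + d + t *\<^sub>R v \<in> X" if "z \<in> closure W" "\<bar>t\<bar> < 2" "d \<in> C (q + 2)" for z t d
  proof -
    have "(z - p) + d \<in> C (Suc q)"
      by (rule C_add) (use clW that in auto)
    moreover have "(t / 2) *\<^sub>R (v + v) \<in> C (q + 2)"
      using disk_scaleR[OF disk_C two_v, of "t / 2"] that by simp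
    then have "t *\<^sub>R v \<in> C (Suc q)"
      using C_antimono[of "Suc q" "q + 2"] by (auto simp flip: scaleR_2)
    ultimately have "(z - p) + d + t *\<^sub>R v \<in> C q"
      by (rule C_add)
    then show ?thesis
      by (intro q) (simp add: algebra_simps)
  qed
  show "\<exists>W. open W \<and> p \<in> W \<and> closure W \<subseteq> X \<and>
      (\<forall>Z. (\<forall>i. open (Z i) \<and> Z i \<noteq> {} \<and> Z i \<subseteq> closure W \<and> closure (Z (Suc i)) \<subseteq> closure (Z i)) \<and>
          (\<Inter>i::nat. closure (Z i)) = {} \<longrightarrow>
        (\<exists>h\<in>carrier GG. \<forall>i. (\<exists>z\<in>Z i. h z = z) \<and> (\<exists>z\<in>Z i. h z \<notin> closure W)))"
  proof (intro exI[of _ W] conjI allI impI)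
    show "open W" "p \<in> W" "closure W \<subseteq> X"
      using open_C_translate clX by (auto simp: W_def)
    fix Z :: "nat \<Rightarrow> 'a set"
    assume Z: "(\<forall>i. open (Z i) \<and> Z i \<noteq> {} \<and> Z i \<subseteq> closure W \<and> closure (Z (Suc i)) \<subseteq> closure (Z i)) \<and>
        (\<Inter>i. closure (Z i)) = {}"
    interpret vanishing_sequence C v "closure W" X "q + 2" Z
      by unfold_locales (use Z thin inside open_X in auto)
    obtain \<phi> where \<phi>: "shear C \<phi> v (1/2) X" "\<And>i. \<exists>y\<in>Z i. \<exists>z\<in>Z i. \<phi> y = 0 \<and> \<phi> z = 1"
      using ex_shear by blast
    obtain h where h: "h \<in> G" "\<And>x. x \<in> X \<Longrightarrow> h x = x + \<phi> x *\<^sub>R v"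
      using shear_in_G[OF \<phi>(1)] by blast
    have "(\<exists>z\<in>Z i. h z = z) \<and> (\<exists>z\<in>Z i. h z \<notin> closure W)" for i
    proof -
      obtain y z where yz: "y \<in> Z i" "z \<in> Z i" "\<phi> y = 0" "\<phi> z = 1"
        using \<phi>(2) by blast
      then have "h y = y" "h z = z + 1 *\<^sub>R v"
        using h(2) Z clX by (metis add.right_neutral scaleR_zero_left subsetD, metis subsetD)
      moreover have "z + 1 *\<^sub>R v \<notin> closure W"
        using thin[of z 1] yz Z by auto
      ultimately show ?thesis
        using yz by metis
    qed
    then show "\<exists>h\<in>carrier GG. \<forall>i. (\<exists>z\<in>Z i. h z = z) \<and> (\<exists>z\<in>Z i. h z \<notin> closure W)"
      using h by auto
  qed
qed

text \<open>This rules out an isomorphism with the one-element group of the zero space.\<close>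

lemma ex_distinct: "X \<noteq> {} \<Longrightarrow> \<exists>g\<in>G. \<exists>h\<in>G. g \<noteq> h"
  using small.nontrivial_in[OF open_X _ subset_refl] small.one_closed by (metis partial_object.select_convs(1) partial_object.update_convs(1) partial_object.surjective)

end

lemma K_M_lc_pair:
  assumes SG: "(S, G) \<in> (K_M :: ('a::topological_real_vector topology \<times> ('a \<Rightarrow> 'a) set) set)"
    and nontriv: "\<exists>v::'a. v \<noteq> 0"
  obtains C X where "S = top_of_set X" "X \<noteq> {}" "lc_pair C X G"
proof -
  obtain X where X: "S = top_of_set X" "X \<noteq> {}" "locally_convex_space TYPE('a)"
      "metrizable_space (euclidean :: 'a topology)" "open X" "subgroup G (homeo_group (top_of_set X))"
      "{h \<in> carrier (homeo_group (top_of_set X)). locally_bi_uniformly_continuous X h} \<subseteq> G"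
    using SG by (auto simp: K_M_def space_group_pair_def)
  obtain C :: "nat \<Rightarrow> 'a set" where C: "disk_base C"
    using ex_disk_base[OF X(3,4)] by blast
  have "lc_pair C X G"
    by (intro lc_pair.intro lc_pair_axioms.intro C) (use X nontriv in auto)
  then show thesis
    using that X by blast
qed

lemma K_M_trivial:
  assumes SG: "(S, G) \<in> (K_M :: ('a::topological_real_vector topology \<times> ('a \<Rightarrow> 'a) set) set)"
    and triv: "\<And>v::'a. v = 0"
  shows "S = top_of_set {0}" "G = {restrict (\<lambda>_. 0) {0}}"
proof -
  obtain X where X: "S = top_of_set X" "X \<noteq> {}" "subgroup G (homeo_group (top_of_set X))"
    using SG by (auto simp: K_M_def space_group_pair_def)
  have X0: "X = {0}"
    using X(2) triv by (metis equals0I insertI1 is_singletonI' is_singleton_def singletonD)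
  then show "S = top_of_set {0}"
    using X by simp
  have "g = restrict (\<lambda>_. 0) {0}" if "g \<in> G" for g
  proof (rule extensionalityI)
    show "g \<in> extensional {0}"
      using subgroup.subset[OF X(3)] that X0 by (auto simp: homeo_group_def dest: Bij_imp_extensional)
    show "g x = restrict (\<lambda>_. 0) {0} x" for x
      using triv by metis
  qed simp
  moreover have "G \<noteq> {}"
    using subgroup.one_closed[OF X(3)] by blast
  ultimately show "G = {restrict (\<lambda>_. 0) {0}}"
    by blast
qed

theorem theoremD:
  shows "faithful
    (K_M :: ('a::topological_real_vector topology \<times> ('a \<Rightarrow> 'a) set) set)
    (K_M :: ('b::topological_real_vector topology \<times> ('b \<Rightarrow> 'b) set) set)"
  unfolding faithful_def
proof clarify
  fix S :: "'a topology" and G and T :: "'b topology" and H and \<phi>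
  assume SG: "(S, G) \<in> K_M" and TH: "(T, H) \<in> K_M"
    and phi: "\<phi> \<in> iso (homeo_group S \<lparr>carrier := G\<rparr>) (homeo_group T \<lparr>carrier := H\<rparr>)"
  then have bij: "bij_betw \<phi> G H"
    by (simp add: iso_def)
  show "\<exists>\<tau>. homeomorphic_map S T \<tau> \<and>
    (\<forall>g\<in>G. \<forall>y\<in>topspace T. \<phi> g y = \<tau> (g (inv_into (topspace S) \<tau> y)))"
  proof (cases "(\<exists>v::'a. v \<noteq> 0) \<and> (\<exists>w::'b. w \<noteq> 0)")
    case True
    obtain C X where X: "S = top_of_set X" "lc_pair C X G"
      using K_M_lc_pair[OF SG] True by metis
    obtain D Y where Y: "T = top_of_set Y" "lc_pair D Y H"
      using K_M_lc_pair[OF TH] True by metis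
    interpret X: lc_pair C X G
      by (rule X)
    interpret Y: lc_pair D Y H
      by (rule Y)
    interpret locally_moving_iso X.GG X Y.GG Y \<phi>
      by (intro locally_moving_iso.intro X.locally_moving_G Y.locally_moving_G group_iso.intro
          X.group_GG Y.group_GG group_iso_axioms.intro) (use phi X Y in simp)
    show ?thesis
      using reconstruction X(1) Y(1) by simp
  next
    case False
    \<comment> \<open>If exactly one of the spaces were zero, \<open>\<phi>\<close> would be a
      bijection between a one-element group and a group with two distinct elements.\<close>
    have "(\<forall>v::'a. v = 0) \<and> (\<forall>w::'b. w = 0)"
    proof (rule ccontr)
      assume *: "\<not> ((\<forall>v::'a. v = 0) \<and> (\<forall>w::'b. w = 0))"
      show False
      proof (cases "\<exists>v::'a. v \<noteq> 0")
        case True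
        then have "\<And>w::'b. w = 0"
          using False by blast
        then have H: "H = {restrict (\<lambda>_. 0) {0}}"
          using K_M_trivial[OF TH] by blast
        obtain C X where "X \<noteq> {}" "lc_pair C X G"
          using K_M_lc_pair[OF SG True] by metis
        then obtain g h where gh: "g \<in> G" "h \<in> G" "g \<noteq> h"
          using lc_pair.ex_distinct by metis
        then have "\<phi> g = \<phi> h"
          using bij_betwE[OF bij] H by auto
        then show False
          using gh bij_betw_imp_inj_on[OF bij] by (auto dest: inj_onD)
      next
        case v: False
        then have G: "G = {restrict (\<lambda>_. 0) {0}}"
          using K_M_trivial[OF SG] by blast
        obtain D Y where "Y \<noteq> {}" "lc_pair D Y H"
          using K_M_lc_pair[OF TH] * v by metis
        then obtain g h where gh: "g \<in> H" "h \<in> H" "g \<noteq> h"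
          using lc_pair.ex_distinct by metis
        then show False
          using bij_betw_imp_surj_on[OF bij] G by auto
      qed
    qed
    then have triv: "v = 0" "w = 0" for v :: 'a and w :: 'b
      by auto
    have S: "S = top_of_set {0}" and T: "T = top_of_set {0}"
      using K_M_trivial(1)[OF SG triv(1)] K_M_trivial(1)[OF TH triv(2)] by auto
    have "homeomorphic_maps S T (\<lambda>_. 0) (\<lambda>_. 0)"
      unfolding homeomorphic_maps_def S T by simp
    then have "homeomorphic_map S T (\<lambda>_. 0)"
      by (auto simp: homeomorphic_map_maps)
    moreover have "\<phi> g y = 0" for g y
      by (rule triv(2))
    ultimately show ?thesis
      by auto
  qed
qed

end
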